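(* When the number of voters $m$ is a constant, the constructive control variant of Real Value Perception Manipulation (RVPM) can be solved in polynomial time under the $l_\infty$ norm for arbitrary scoring rules.
   Context: Spatial election model: $n$ candidates $c_1,\dots,c_n$ and $m$ voters $v_1,\dots,v_m$ are points of $\mathbb R^d$. Each voter ranks candidates by increasing $l_\infty$ distance; closest ranked 1; original rankings have no ties. A scoring rule is a non-increasing $f:\{1,\dots,n\}\to\mathbb R$: a candidate ranked $t$ by a voter receives $f(t)$; totals summed; highest total wins. Given $\epsilon>0$, an adversary may replace target $c_1$ by any $\tilde c_1\in\mathbb R^d$ with $\|\tilde c_1-c_1\|_\infty\le\epsilon$; ties created by the manipulation are broken in the adversary's favor. Constructive control: decide whether some such $\tilde c_1$ makes $c_1$ win (with $c_1$ placed ahead of equidistant candidates, its total is at least every other candidate's total). *)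

theory Defs
  imports "HOL-Analysis.Analysis"
begin

text \<open>Registers are indexed by natural numbers and hold reals. Indirect addressing
  is only allowed with natural-number addresses; otherwise the machine halts.
  Comparisons are exact real comparisons; arithmetic has unit cost.\<close>

datatype instr =
    Const nat real
  | Add nat nat nat
  | Sub nat nat nat
  | Mul nat nat nat
  | Div nat nat nat
  | Load nat nat
  | Store nat nat
  | JumpLe nat nat nat
  | Goto nat
  | Halt

type_synonym prog = "instr list"
type_synonym state = "nat \<times> (nat \<Rightarrow> real)"

definition halted :: "prog \<Rightarrow> state \<Rightarrow> bool" where
  "halted P s \<longleftrightarrow> fst s \<ge> length P"

fun exec_instr :: "prog \<Rightarrow> instr \<Rightarrow> nat \<Rightarrow> (nat \<Rightarrow> real) \<Rightarrow> state" where
  "exec_instr P (Const i r) pc R = (Suc pc, R(i := r))"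
| "exec_instr P (Add i j k) pc R = (Suc pc, R(i := R j + R k))"
| "exec_instr P (Sub i j k) pc R = (Suc pc, R(i := R j - R k))"
| "exec_instr P (Mul i j k) pc R = (Suc pc, R(i := R j * R k))"
| "exec_instr P (Div i j k) pc R = (Suc pc, R(i := R j / R k))"
| "exec_instr P (Load i j) pc R =
     (if R j \<in> \<nat> then (Suc pc, R(i := R (nat \<lfloor>R j\<rfloor>))) else (length P, R))"
| "exec_instr P (Store i j) pc R =
     (if R j \<in> \<nat> then (Suc pc, R(nat \<lfloor>R j\<rfloor> := R i)) else (length P, R))"
| "exec_instr P (JumpLe j k l) pc R = (if R j \<le> R k then (l, R) else (Suc pc, R))"
| "exec_instr P (Goto l) pc R = (l, R)"
| "exec_instr P Halt pc R = (length P, R)"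

definition step :: "prog \<Rightarrow> state \<Rightarrow> state" where
  "step P s = (if halted P s then s else exec_instr P (P ! fst s) (fst s) (snd s))"

definition run :: "prog \<Rightarrow> nat \<Rightarrow> state \<Rightarrow> state" where
  "run P t s = (step P ^^ t) s"

definition init_state :: "real list \<Rightarrow> state" where
  "init_state xs = (0, (\<lambda>i. if i < length xs then xs ! i else 0))"

definition decides_within :: "prog \<Rightarrow> real list \<Rightarrow> nat \<Rightarrow> bool \<Rightarrow> bool" where
  "decides_within P xs T b \<longleftrightarrow>
     (\<exists>t\<le>T. halted P (run P t (init_state xs)) \<and>
             (snd (run P t (init_state xs)) 0 = 1 \<longleftrightarrow> b))"

text \<open>Points of R^d are functions nat => real, coordinates 0..d-1.
  Candidates are indexed 0..n-1 (index 0 is the target c_1), voters 0..m-1.\<close>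

definition linf :: "nat \<Rightarrow> (nat \<Rightarrow> real) \<Rightarrow> (nat \<Rightarrow> real) \<Rightarrow> real" where
  "linf d x y = (MAX k\<in>{..<d}. \<bar>x k - y k\<bar>)"

text \<open>Rank (1 = best) of candidate j for voter v after c_1 (index 0) is moved to p;
  ties created by the manipulation are broken in favour of c_1.\<close>
definition rank_after :: "nat \<Rightarrow> nat \<Rightarrow> (nat \<Rightarrow> nat \<Rightarrow> real) \<Rightarrow> (nat \<Rightarrow> nat \<Rightarrow> real)
    \<Rightarrow> (nat \<Rightarrow> real) \<Rightarrow> nat \<Rightarrow> nat \<Rightarrow> nat" where
  "rank_after n d C V p v j =
     (if j = 0 then 1 + card {i. 1 \<le> i \<and> i < n \<and> linf d (V v) (C i) < linf d (V v) p}
      else 1 + card {i. 1 \<le> i \<and> i < n \<and> i \<noteq> j \<and> linf d (V v) (C i) < linf d (V v) (C j)}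
             + (if linf d (V v) p \<le> linf d (V v) (C j) then 1 else 0))"

definition score_after :: "nat \<Rightarrow> nat \<Rightarrow> nat \<Rightarrow> (nat \<Rightarrow> real) \<Rightarrow> (nat \<Rightarrow> nat \<Rightarrow> real)
    \<Rightarrow> (nat \<Rightarrow> nat \<Rightarrow> real) \<Rightarrow> (nat \<Rightarrow> real) \<Rightarrow> nat \<Rightarrow> real" where
  "score_after n m d f C V p j = (\<Sum>v<m. f (rank_after n d C V p v j))"

definition constructive_control :: "nat \<Rightarrow> nat \<Rightarrow> nat \<Rightarrow> real \<Rightarrow> (nat \<Rightarrow> real)
    \<Rightarrow> (nat \<Rightarrow> nat \<Rightarrow> real) \<Rightarrow> (nat \<Rightarrow> nat \<Rightarrow> real) \<Rightarrow> bool" where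
  "constructive_control n m d eps f C V \<longleftrightarrow>
     (\<exists>p. linf d p (C 0) \<le> eps \<and>
          (\<forall>j. 1 \<le> j \<and> j < n \<longrightarrow> score_after n m d f C V p j \<le> score_after n m d f C V p 0))"

definition valid_instance :: "nat \<Rightarrow> nat \<Rightarrow> nat \<Rightarrow> real \<Rightarrow> (nat \<Rightarrow> real)
    \<Rightarrow> (nat \<Rightarrow> nat \<Rightarrow> real) \<Rightarrow> (nat \<Rightarrow> nat \<Rightarrow> real) \<Rightarrow> bool" where
  "valid_instance n m d eps f C V \<longleftrightarrow>
     1 \<le> n \<and> 1 \<le> d \<and> eps > 0 \<and>
     (\<forall>s t. 1 \<le> s \<longrightarrow> s \<le> t \<longrightarrow> t \<le> n \<longrightarrow> f t \<le> f s) \<and>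
     (\<forall>v<m. \<forall>i<n. \<forall>j<n. i \<noteq> j \<longrightarrow> linf d (V v) (C i) \<noteq> linf d (V v) (C j))"

definition encode :: "nat \<Rightarrow> nat \<Rightarrow> nat \<Rightarrow> real \<Rightarrow> (nat \<Rightarrow> real)
    \<Rightarrow> (nat \<Rightarrow> nat \<Rightarrow> real) \<Rightarrow> (nat \<Rightarrow> nat \<Rightarrow> real) \<Rightarrow> real list" where
  "encode n m d eps f C V =
     [real n, real m, real d, eps] @ map f [1..<n+1]
     @ concat (map (\<lambda>i. map (C i) [0..<d]) [0..<n])
     @ concat (map (\<lambda>v. map (V v) [0..<d]) [0..<m])"

end

theory Submission
  imports Defs
begin

text \<open>Moving the target closer to a voter never worsens its rank there and never improves the
  rank of a competitor, so for a scoring rule it only matters which upper bounds \<open>r\<^sub>v\<close> on its distances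
  to the voters can be met, and each \<open>r\<^sub>v\<close> may be taken to be the distance of \<open>v\<close> to a competitor
  (or a bound that always holds). This leaves \<open>n ^ m\<close> profiles. A profile can be met iff the
  \<open>l\<^sub>\<infinity>\<close> balls around the voters and the ball of radius \<open>eps\<close> around \<open>c\<^sub>1\<close> have a common point,
  which is an intersection of intervals in each coordinate. The machine enumerates the profiles as
  numbers in base \<open>n\<close>; its program is compiled from a single arithmetic expression whose only
  control structure is bounded iteration, so that polynomial running time is visible from the
  loop bounds \<open>n\<close>, \<open>m\<close>, \<open>d\<close> and \<open>n ^ m\<close>.\<close>

section \<open>Structured code with time bounds\<close>

text \<open>The theorem asks for one program that serves every \<open>m\<close>; only the polynomial
  may depend on \<open>m\<close>. The machine has no integer division and no rounding, and it halts
  at an address that is not natural, so quotients and digits are obtained by counting. Instructions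
  name fixed registers, while the input fills arbitrarily many registers from 0 on. Hence the input
  is copied upwards to an address \<open>A\<close> that is kept in a register, and the registers
  below get fixed roles. \<open>A\<close> has to be computed without a free register: ten
  self-doublings give the factor 1024, and since \<open>n + (n + m) * d \<ge> 2\<close> this yields
  \<open>A \<ge> 2048\<close>, enough for 16 reserved and variable registers and at most 2000
  temporaries. Ties favour the target, so a bound on its distance may be attained: the balls are
  closed, and comparing interval ends with \<open>\<le>\<close> decides whether they meet.\<close>

type_synonym regs = "nat \<Rightarrow> real"
type_synonym code = "nat \<Rightarrow> instr list"

definition code_at :: "prog \<Rightarrow> nat \<Rightarrow> instr list \<Rightarrow> bool" where
  "code_at P pc is \<longleftrightarrow> (\<exists>pre post. P = pre @ is @ post \<and> length pre = pc)"

text \<open>Jump targets are absolute, so code is a function of its start address. Quantifying over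
  every program that contains it at that address makes the judgement compositional.\<close>

definition exec :: "code \<Rightarrow> regs \<Rightarrow> nat \<Rightarrow> regs \<Rightarrow> bool" where
  "exec c R T R' \<longleftrightarrow> (\<forall>P pc. code_at P pc (c pc) \<longrightarrow>
     (\<exists>t\<le>T. run P t (pc, R) = (pc + length (c pc), R')))"

definition seq :: "code \<Rightarrow> code \<Rightarrow> code" (infixl ";;" 60) where
  "(c ;; c') pc = c pc @ c' (pc + length (c pc))"

definition cond :: "nat \<Rightarrow> nat \<Rightarrow> code \<Rightarrow> code \<Rightarrow> code" where
  "cond i j c c' pc =
     (let is' = c' (pc + 1); l = pc + length is' + 2; is = c l
      in JumpLe i j l # is' @ Goto (l + length is) # is)"

definition until :: "nat \<Rightarrow> nat \<Rightarrow> code \<Rightarrow> code" where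
  "until i j c pc =
     (let is = c (pc + 1) in JumpLe i j (pc + length is + 2) # is @ [Goto pc])"

lemma code_at_append:
  "code_at P pc (is @ is') \<longleftrightarrow> code_at P pc is \<and> code_at P (pc + length is) is'"
proof
  assume "code_at P pc (is @ is')"
  then obtain pre post where "P = pre @ is @ is' @ post" "length pre = pc"
    by (auto simp: code_at_def)
  then show "code_at P pc is \<and> code_at P (pc + length is) is'"
    unfolding code_at_def by (metis append.assoc length_append)
next
  assume "code_at P pc is \<and> code_at P (pc + length is) is'"
  then obtain pre post pre' post' where P: "P = pre @ is @ post" "length pre = pc"
      "P = pre' @ is' @ post'" "length pre' = pc + length is"
    unfolding code_at_def by blast
  then have "pre' = pre @ is"
    by (metis append.assoc append_eq_append_conv length_append)
  with P show "code_at P pc (is @ is')"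
    unfolding code_at_def by (metis append.assoc)
qed

lemma code_at_Cons:
  "code_at P pc (ins # is) \<longleftrightarrow> code_at P pc [ins] \<and> code_at P (Suc pc) is"
  using code_at_append[of P pc "[ins]" "is"] by simp

lemma code_at_nth: "code_at P pc [ins] \<Longrightarrow> pc < length P \<and> P ! pc = ins"
  by (auto simp: code_at_def nth_append)

lemma step_code_at:
  "code_at P pc [ins] \<Longrightarrow> step P (pc, R) = exec_instr P ins pc R"
  using code_at_nth[of P pc ins] by (simp add: step_def halted_def)

lemma run_0: "run P 0 s = s"
  by (simp add: run_def)

lemma run_add: "run P (t + t') s = run P t' (run P t s)"
  by (simp add: run_def add.commute[of t] funpow_add)

lemma run_Suc: "run P (Suc t) s = run P t (step P s)"
  by (simp add: run_def funpow_Suc_right del: funpow.simps)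

lemma exec_mono: "exec c R T R' \<Longrightarrow> T \<le> T' \<Longrightarrow> exec c R T' R'"
  unfolding exec_def by (meson order_trans)

lemma exec_seq:
  assumes "exec c R T R'" "exec c' R' T' R''"
  shows "exec (c ;; c') R (T + T') R''"
  unfolding exec_def
proof (intro allI impI)
  fix P pc assume "code_at P pc ((c ;; c') pc)"
  then have *: "code_at P pc (c pc)" "code_at P (pc + length (c pc)) (c' (pc + length (c pc)))"
    by (simp_all add: seq_def code_at_append)
  from * assms obtain t t' where
    "t \<le> T" "run P t (pc, R) = (pc + length (c pc), R')"
    "t' \<le> T'" "run P t' (pc + length (c pc), R') =
       (pc + length (c pc) + length (c' (pc + length (c pc))), R'')"
    unfolding exec_def by blast
  then show "\<exists>t\<le>T + T'. run P t (pc, R) = (pc + length ((c ;; c') pc), R'')"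
    by (intro exI[of _ "t + t'"]) (simp add: run_add seq_def)
qed

lemma exec_cond:
  assumes "if R i \<le> R j then exec c R T R' else exec c' R T R'"
  shows "exec (cond i j c c') R (T + 2) R'"
  unfolding exec_def
proof (intro allI impI)
  fix P pc assume at: "code_at P pc (cond i j c c' pc)"
  define l where "l = pc + length (c' (pc + 1)) + 2"
  have at': "code_at P pc [JumpLe i j l]" "code_at P (Suc pc) (c' (pc + 1))"
      "code_at P (pc + length (c' (pc + 1)) + 1) [Goto (l + length (c l))]" "code_at P l (c l)"
    using at by (simp_all add: cond_def Let_def l_def code_at_append
        code_at_Cons[of _ _ _ "_ # _"] code_at_Cons[of _ _ _ "_ @ _"] code_at_Cons[of _ _ _ "c _"])
  have len: "length (cond i j c c' pc) = length (c' (pc + 1)) + length (c l) + 2"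
    by (simp add: cond_def Let_def l_def)
  show "\<exists>t\<le>T + 2. run P t (pc, R) = (pc + length (cond i j c c' pc), R')"
  proof (cases "R i \<le> R j")
    case True
    with assms at' obtain t where "t \<le> T" "run P t (l, R) = (l + length (c l), R')"
      unfolding exec_def by auto
    with True at' show ?thesis
      by (intro exI[of _ "Suc t"]) (simp add: run_Suc step_code_at len l_def)
  next
    case False
    with assms at' obtain t where t: "t \<le> T"
        "run P t (Suc pc, R) = (Suc pc + length (c' (pc + 1)), R')"
      unfolding exec_def by (metis Suc_eq_plus1)
    have "run P (Suc t + 1) (pc, R) = (pc + length (cond i j c c' pc), R')"
      using False at' t unfolding run_add
      by (simp add: run_Suc run_0 step_code_at len l_def)
    with t show ?thesis
      by (intro exI[of _ "Suc t + 1"]) simp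
  qed
qed

lemma exec_until_exit:
  assumes "R i \<le> R j"
  shows "exec (until i j c) R 1 R"
  unfolding exec_def
proof (intro allI impI)
  fix P pc assume "code_at P pc (until i j c pc)"
  then have "code_at P pc [JumpLe i j (pc + length (c (pc + 1)) + 2)]"
    by (simp add: until_def Let_def code_at_Cons[of _ _ _ "_ @ _"])
  then show "\<exists>t\<le>1. run P t (pc, R) = (pc + length (until i j c pc), R)"
    using assms by (intro exI[of _ 1]) (simp add: run_Suc[of _ 0, simplified] run_0 step_code_at until_def Let_def)
qed

lemma exec_until_iterate:
  assumes "\<not> R i \<le> R j" "exec c R T R'" "exec (until i j c) R' T' R''"
  shows "exec (until i j c) R (T + 2 + T') R''"
  unfolding exec_def
proof (intro allI impI)
  fix P pc assume at: "code_at P pc (until i j c pc)"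
  then have at': "code_at P pc [JumpLe i j (pc + length (c (pc + 1)) + 2)]"
     "code_at P (Suc pc) (c (pc + 1))" "code_at P (pc + length (c (pc + 1)) + 1) [Goto pc]"
    by (simp_all add: until_def Let_def code_at_append
        code_at_Cons[of _ _ _ "_ # _"] code_at_Cons[of _ _ _ "_ @ _"])
  from assms at at' obtain t t' where t: "t \<le> T"
      "run P t (Suc pc, R) = (Suc pc + length (c (pc + 1)), R')"
      "t' \<le> T'" "run P t' (pc, R') = (pc + length (until i j c pc), R'')"
    unfolding exec_def by fastforce
  have "run P (Suc t + Suc t') (pc, R) = (pc + length (until i j c pc), R'')"
    using assms(1) at' t unfolding run_add by (simp add: run_Suc run_0 step_code_at)
  with t show "\<exists>t\<le>T + 2 + T'. run P t (pc, R) = (pc + length (until i j c pc), R'')"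
    by (intro exI[of _ "Suc t + Suc t'"]) simp
qed

text \<open>Induction on the number \<open>r\<close> of rounds still to run. Each round pays 2 steps
  for the test and the jump back, the exit pays 1.\<close>

lemma exec_until:
  assumes step: "\<And>k R. k < N \<Longrightarrow> I k R \<Longrightarrow> \<not> R i \<le> R j \<and> (\<exists>R'. exec c R T R' \<and> I (Suc k) R')"
    and exit: "\<And>R. I N R \<Longrightarrow> R i \<le> R j"
    and init: "I 0 R"
  shows "\<exists>R'. exec (until i j c) R (N * (T + 2) + 1) R' \<and> I N R'"
proof -
  have "\<exists>R'. exec (until i j c) R (r * (T + 2) + 1) R' \<and> I N R'"
    if "r \<le> N" "I (N - r) R" for r R
    using that
  proof (induction r arbitrary: R)
    case 0
    then show ?case using exec_until_exit[of R i j c] exit by auto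
  next
    case (Suc r)
    then obtain R' where "\<not> R i \<le> R j" "exec c R T R'" "I (N - r) R'"
      using step[of "N - Suc r" R] by (auto simp: Suc_diff_Suc)
    with Suc.IH[of R'] Suc.prems obtain R'' where
      "exec (until i j c) R' (r * (T + 2) + 1) R''" "I N R''" by auto
    then show ?case
      using exec_until_iterate[of R i j c T R'] \<open>\<not> R i \<le> R j\<close> \<open>exec c R T R'\<close>
      by (intro exI[of _ R'']) (fastforce simp: algebra_simps)
  qed
  from this[of N R] init show ?thesis by simp
qed

text \<open>Symbolic execution of straight-line code by simplification. \<open>None\<close> covers
  jumps, \<open>Halt\<close> and illegal addresses, so a \<open>Some\<close> result certifies that
  control falls through.\<close>

fun effect :: "instr \<Rightarrow> regs \<Rightarrow> regs option" where
  "effect (Const i r) R = Some (R(i := r))"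
| "effect (Add i j k) R = Some (R(i := R j + R k))"
| "effect (Sub i j k) R = Some (R(i := R j - R k))"
| "effect (Mul i j k) R = Some (R(i := R j * R k))"
| "effect (Div i j k) R = Some (R(i := R j / R k))"
| "effect (Load i j) R = (if R j \<in> \<nat> then Some (R(i := R (nat \<lfloor>R j\<rfloor>))) else None)"
| "effect (Store i j) R = (if R j \<in> \<nat> then Some (R(nat \<lfloor>R j\<rfloor> := R i)) else None)"
| "effect _ R = None"

fun effects :: "instr list \<Rightarrow> regs \<Rightarrow> regs option" where
  "effects [] R = Some R"
| "effects (ins # is) R = Option.bind (effect ins R) (effects is)"

lemma effects_append: "effects (is @ is') R = Option.bind (effects is R) (effects is')"
  proof (induction "is" arbitrary: R)
  case (Cons ins "is")
  then show ?case by (cases "effect ins R") auto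
qed simp

lemma exec_instr_effect: "effect ins R = Some R' \<Longrightarrow> exec_instr P ins pc R = (Suc pc, R')"
  by (cases ins) (auto split: if_splits)

lemma exec_effects:
  "effects is R = Some R' \<Longrightarrow> exec (\<lambda>_. is) R (length is) R'"
proof (induction "is" arbitrary: R)
  case Nil
  then show ?case by (auto simp: exec_def run_0)
next
  case (Cons ins "is")
  then obtain R1 where 1: "effect ins R = Some R1" "effects is R1 = Some R'"
    by (auto simp: bind_eq_Some_conv)
  show ?case
    unfolding exec_def
  proof (intro allI impI)
    fix P pc assume "code_at P pc (ins # is)"
    then have at: "code_at P pc [ins]" "code_at P (Suc pc) is"
      by (simp_all add: code_at_Cons[of _ _ _ "is"])
    with Cons.IH[OF 1(2)] obtain t where "t \<le> length is"
        "run P t (Suc pc, R1) = (Suc pc + length is, R')"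
      unfolding exec_def by blast
    then show "\<exists>t\<le>length (ins # is). run P t (pc, R) = (pc + length (ins # is), R')"
      using at 1 by (intro exI[of _ "Suc t"]) (simp add: run_Suc step_code_at exec_instr_effect)
  qed
qed

section \<open>Arithmetic expressions with bounded iteration\<close>

text \<open>\<open>Iter a x b i e\<close> starts the accumulator \<open>a\<close> at \<open>i\<close>
  and updates it to \<open>e\<close> for each \<open>x = 0, 1, \<dots>\<close> below \<open>b\<close>.\<close>

datatype exp =
    Num real
  | Var nat
  | Plus exp exp
  | Minus exp exp
  | Times exp exp
  | Inp exp
  | IfLe exp exp exp exp
  | Iter nat nat exp exp exp

text \<open>The bound of \<open>Iter\<close> is rounded up because the compiled loop counts
  \<open>x\<close> from 0 until the bound is \<open>\<le>\<close> \<open>x\<close>; this takes as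
  many rounds as the ceiling of the bound, and none if the bound is negative.\<close>

fun eval :: "regs \<Rightarrow> exp \<Rightarrow> regs \<Rightarrow> real" where
  "eval inp (Num r) env = r"
| "eval inp (Var x) env = env x"
| "eval inp (Plus e e') env = eval inp e env + eval inp e' env"
| "eval inp (Minus e e') env = eval inp e env - eval inp e' env"
| "eval inp (Times e e') env = eval inp e env * eval inp e' env"
| "eval inp (Inp e) env = inp (nat \<lfloor>eval inp e env\<rfloor>)"
| "eval inp (IfLe e1 e2 e3 e4) env =
     (if eval inp e1 env \<le> eval inp e2 env then eval inp e3 env else eval inp e4 env)"
| "eval inp (Iter a x b i e) env =
     rec_nat (eval inp i env) (\<lambda>k acc. eval inp e (env(a := acc, x := real k)))
       (nat \<lceil>eval inp b env\<rceil>)"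

text \<open>The machine halts on loads from addresses that are not natural numbers, so these have to be
  excluded.\<close>

fun safe :: "nat \<Rightarrow> regs \<Rightarrow> exp \<Rightarrow> regs \<Rightarrow> bool" where
  "safe M inp (Num r) env = True"
| "safe M inp (Var x) env = True"
| "safe M inp (Plus e e') env = (safe M inp e env \<and> safe M inp e' env)"
| "safe M inp (Minus e e') env = (safe M inp e env \<and> safe M inp e' env)"
| "safe M inp (Times e e') env = (safe M inp e env \<and> safe M inp e' env)"
| "safe M inp (Inp e) env = (safe M inp e env \<and> eval inp e env \<in> \<nat>)"
| "safe M inp (IfLe e1 e2 e3 e4) env =
     (safe M inp e1 env \<and> safe M inp e2 env \<and> safe M inp e3 env \<and> safe M inp e4 env)"
| "safe M inp (Iter a x b i e) env =
     (safe M inp b env \<and> safe M inp i env \<and> nat \<lceil>eval inp b env\<rceil> \<le> M \<and>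
      (\<forall>k<nat \<lceil>eval inp b env\<rceil>. safe M inp e (env(a :=
         rec_nat (eval inp i env) (\<lambda>k acc. eval inp e (env(a := acc, x := real k))) k,
         x := real k))))"

text \<open>Registers 0, 1 and 2 are reserved for the compiled code, variables occupy the registers
  from 3 up to \<open>V\<close>, and temporaries follow.\<close>

fun wf_exp :: "nat \<Rightarrow> exp \<Rightarrow> bool" where
  "wf_exp V (Num r) = True"
| "wf_exp V (Var x) = (3 \<le> x \<and> x < V)"
| "wf_exp V (Plus e e') = (wf_exp V e \<and> wf_exp V e')"
| "wf_exp V (Minus e e') = (wf_exp V e \<and> wf_exp V e')"
| "wf_exp V (Times e e') = (wf_exp V e \<and> wf_exp V e')"
| "wf_exp V (Inp e) = wf_exp V e"
| "wf_exp V (IfLe e1 e2 e3 e4) = (wf_exp V e1 \<and> wf_exp V e2 \<and> wf_exp V e3 \<and> wf_exp V e4)"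
| "wf_exp V (Iter a x b i e) =
     (3 \<le> a \<and> a < V \<and> 3 \<le> x \<and> x < V \<and> a \<noteq> x \<and> wf_exp V b \<and> wf_exp V i \<and> wf_exp V e)"

fun width :: "exp \<Rightarrow> nat" where
  "width (Num r) = 1"
| "width (Var x) = 1"
| "width (Plus e e') = max (width e) (width e' + 1)"
| "width (Minus e e') = max (width e) (width e' + 1)"
| "width (Times e e') = max (width e) (width e' + 1)"
| "width (Inp e) = width e"
| "width (IfLe e1 e2 e3 e4) =
     max (width e1) (max (width e2 + 1) (max (width e3) (width e4)))"
| "width (Iter a x b i e) = max (width i) (max (width b + 1) (width e + 4))"

text \<open>Temporaries form a stack starting at \<open>h\<close>, which also receives the result.
  At run time registers 0, 1, 2 hold the input offset, 1 and 0, so adding register 2 is a move and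
  adding register 0 turns an input index into an address. \<open>Iter\<close> keeps the bound in
  \<open>h + 1\<close> and saves the outer values of \<open>a\<close> and \<open>x\<close> in
  \<open>h + 2\<close> and \<open>h + 3\<close>, which makes shadowing harmless.\<close>

fun compile :: "exp \<Rightarrow> nat \<Rightarrow> code" where
  "compile (Num r) h = (\<lambda>_. [Const h r])"
| "compile (Var x) h = (\<lambda>_. [Add h x 2])"
| "compile (Plus e e') h = compile e h ;; compile e' (h + 1) ;; (\<lambda>_. [Add h h (h + 1)])"
| "compile (Minus e e') h = compile e h ;; compile e' (h + 1) ;; (\<lambda>_. [Sub h h (h + 1)])"
| "compile (Times e e') h = compile e h ;; compile e' (h + 1) ;; (\<lambda>_. [Mul h h (h + 1)])"
| "compile (Inp e) h = compile e h ;; (\<lambda>_. [Add h h 0, Load h h])"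
| "compile (IfLe e1 e2 e3 e4) h =
     compile e1 h ;; compile e2 (h + 1) ;; cond h (h + 1) (compile e3 h) (compile e4 h)"
| "compile (Iter a x b i e) h =
     compile i h ;; compile b (h + 1) ;;
     (\<lambda>_. [Add (h + 2) a 2, Add (h + 3) x 2, Add a h 2, Const x 0]) ;;
     until (h + 1) x (compile e (h + 4) ;; (\<lambda>_. [Add a (h + 4) 2, Add x x 1])) ;;
     (\<lambda>_. [Add h a 2, Add a (h + 2) 2, Add x (h + 3) 2])"

text \<open>\<open>M\<close> bounds the rounds of every loop, as \<open>safe\<close> guarantees, so
  the cost is independent of the environment.\<close>

fun cost :: "nat \<Rightarrow> exp \<Rightarrow> nat" where
  "cost M (Num r) = 1"
| "cost M (Var x) = 1"
| "cost M (Plus e e') = cost M e + cost M e' + 1"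
| "cost M (Minus e e') = cost M e + cost M e' + 1"
| "cost M (Times e e') = cost M e + cost M e' + 1"
| "cost M (Inp e) = cost M e + 2"
| "cost M (IfLe e1 e2 e3 e4) = cost M e1 + cost M e2 + cost M e3 + cost M e4 + 2"
| "cost M (Iter a x b i e) = cost M i + cost M b + M * (cost M e + 4) + 8"

section \<open>Correctness and running time of the compiled code\<close>

definition machine_inv :: "nat \<Rightarrow> regs \<Rightarrow> regs \<Rightarrow> bool" where
  "machine_inv A inp R \<longleftrightarrow> R 0 = real A \<and> R 1 = 1 \<and> R 2 = 0 \<and> (\<forall>i. R (A + i) = inp i)"

definition computes :: "code \<Rightarrow> nat \<Rightarrow> regs \<Rightarrow> nat \<Rightarrow> nat \<Rightarrow> real \<Rightarrow> bool" where
  "computes c T R h w r \<longleftrightarrow>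
     (\<exists>R'. exec c R T R' \<and> R' h = r \<and> (\<forall>q. q < h \<or> h + w \<le> q \<longrightarrow> R' q = R q))"

lemma width_pos: "0 < width e"
  by (induction e) auto

lemma machine_inv_cong:
  assumes "machine_inv A inp R" "\<And>q. q < h \<or> h + w \<le> q \<Longrightarrow> R' q = R q" "3 \<le> h" "h + w \<le> A"
  shows "machine_inv A inp R'"
  using assms by (auto simp: machine_inv_def)

lemma computes_mono:
  assumes "computes c T R h w r" "T \<le> T'" "w \<le> w'"
  shows "computes c T' R h w' r"
proof -
  from assms(1) obtain R' where R': "exec c R T R'" "R' h = r"
      "\<And>q. q < h \<or> h + w \<le> q \<Longrightarrow> R' q = R q"
    unfolding computes_def by blast
  show ?thesis
    unfolding computes_def
    by (intro exI[of _ R'] conjI exec_mono[OF R'(1)] allI impI R') (use assms in auto)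
qed

text \<open>The second operand works from \<open>h + 1\<close> upwards, so its frame condition
  protects the first result in \<open>h\<close>.\<close>

lemma computes_pair:
  assumes "computes c T R h w r"
    and "\<And>R'. (\<And>q. q < h \<or> h + w \<le> q \<Longrightarrow> R' q = R q) \<Longrightarrow> computes c' T' R' (h + 1) w' r'"
  obtains R' where "exec (c ;; c') R (T + T') R'" "R' h = r" "R' (h + 1) = r'"
    "\<And>q. q < h \<or> h + max w (w' + 1) \<le> q \<Longrightarrow> R' q = R q"
proof -
  from assms(1) obtain R1 where R1: "exec c R T R1" "R1 h = r"
      "\<And>q. q < h \<or> h + w \<le> q \<Longrightarrow> R1 q = R q"
    unfolding computes_def by blast
  from assms(2)[OF R1(3)] obtain R2 where R2: "exec c' R1 T' R2" "R2 (h + 1) = r'"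
      "\<And>q. q < h + 1 \<or> h + 1 + w' \<le> q \<Longrightarrow> R2 q = R1 q"
    unfolding computes_def by blast
  have "R2 h = r" using R2(3)[of h] R1(2) by simp
  moreover have "R2 q = R q" if "q < h \<or> h + max w (w' + 1) \<le> q" for q
  proof -
    have "q < h + 1 \<or> h + 1 + w' \<le> q" "q < h \<or> h + w \<le> q" using that by auto
    then show ?thesis using R2(3) R1(3) by metis
  qed
  ultimately show ?thesis using that exec_seq[OF R1(1) R2(1)] R2(2) by blast
qed

lemma computes_binary:
  assumes "computes c T R h w r"
    and "\<And>R'. (\<And>q. q < h \<or> h + w \<le> q \<Longrightarrow> R' q = R q) \<Longrightarrow> computes c' T' R' (h + 1) w' r'"
    and "\<And>R. effect ins R = Some (R(h := g (R h) (R (h + 1))))"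
  shows "computes (c ;; c' ;; (\<lambda>_. [ins])) (T + T' + 1) R h (max w (w' + 1)) (g r r')"
proof -
  obtain R' where R': "exec (c ;; c') R (T + T') R'" "R' h = r" "R' (h + 1) = r'"
      "\<And>q. q < h \<or> h + max w (w' + 1) \<le> q \<Longrightarrow> R' q = R q"
    using computes_pair[OF assms(1,2)] by blast
  have "exec (\<lambda>_. [ins]) R' 1 (R'(h := g r r'))"
    using exec_effects[of "[ins]" R'] assms(3)[of R'] R'(2,3) by simp
  from exec_seq[OF R'(1) this] show ?thesis
    unfolding computes_def using R'(4) by (intro exI[of _ "R'(h := g r r')"]) auto
qed

text \<open>\<open>V \<le> h\<close> keeps the temporaries above the variables and
  \<open>h + width e \<le> A\<close> keeps them below the copied input; the frame condition in
  \<open>computes\<close> then preserves both across subexpressions.\<close>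

lemma compile_correct:
  assumes "safe M inp e env" "wf_exp V e" "machine_inv A inp R"
    "\<And>x. 3 \<le> x \<Longrightarrow> x < V \<Longrightarrow> R x = env x" "3 \<le> V" "V \<le> h" "h + width e \<le> A"
  shows "computes (compile e h) (cost M e) R h (width e) (eval inp e env)"
  using assms
proof (induction e arbitrary: env R h)
  case (Num r)
  then show ?case
    unfolding computes_def
    by (intro exI[of _ "R(h := r)"])
      (use exec_effects[of "[Const h r]" R] in \<open>auto\<close>)
next
  case (Var x)
  then show ?case
    unfolding computes_def
    by (intro exI[of _ "R(h := R x)"])
      (use exec_effects[of "[Add h x 2]" R] in \<open>auto simp: machine_inv_def\<close>)
next
  case (Plus e e')
  have 1: "computes (compile e h) (cost M e) R h (width e) (eval inp e env)"
    using Plus.IH(1)[of env R h] Plus.prems by simp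
  have 2: "computes (compile e' (h + 1)) (cost M e') R' (h + 1) (width e') (eval inp e' env)"
    if "\<And>q. q < h \<or> h + width e \<le> q \<Longrightarrow> R' q = R q" for R'
    using Plus.IH(2)[of env R' "h + 1"] Plus.prems machine_inv_cong[of A inp R h "width e" R'] that
    by simp
  show ?case using computes_binary[OF 1 2, of "Add h h (h + 1)" "(+)"] by simp
next
  case (Minus e e')
  have 1: "computes (compile e h) (cost M e) R h (width e) (eval inp e env)"
    using Minus.IH(1)[of env R h] Minus.prems by simp
  have 2: "computes (compile e' (h + 1)) (cost M e') R' (h + 1) (width e') (eval inp e' env)"
    if "\<And>q. q < h \<or> h + width e \<le> q \<Longrightarrow> R' q = R q" for R'
    using Minus.IH(2)[of env R' "h + 1"] Minus.prems machine_inv_cong[of A inp R h "width e" R'] that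
    by simp
  show ?case using computes_binary[OF 1 2, of "Sub h h (h + 1)" "(-)"] by simp
next
  case (Times e e')
  have 1: "computes (compile e h) (cost M e) R h (width e) (eval inp e env)"
    using Times.IH(1)[of env R h] Times.prems by simp
  have 2: "computes (compile e' (h + 1)) (cost M e') R' (h + 1) (width e') (eval inp e' env)"
    if "\<And>q. q < h \<or> h + width e \<le> q \<Longrightarrow> R' q = R q" for R'
    using Times.IH(2)[of env R' "h + 1"] Times.prems machine_inv_cong[of A inp R h "width e" R'] that
    by simp
  show ?case using computes_binary[OF 1 2, of "Mul h h (h + 1)" "(*)"] by simp
next
  case (Inp e)
  have "computes (compile e h) (cost M e) R h (width e) (eval inp e env)"
    using Inp.IH[of env R h] Inp.prems by simp
  then obtain R1 where R1: "exec (compile e h) R (cost M e) R1" "R1 h = eval inp e env"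
      "\<And>q. q < h \<or> h + width e \<le> q \<Longrightarrow> R1 q = R q"
    unfolding computes_def by blast
  have inv: "machine_inv A inp R1"
    using Inp.prems R1(3) machine_inv_cong[of A inp R h "width e" R1] by simp
  obtain k where k: "eval inp e env = real k"
    using Inp.prems(1) by (auto elim: Nats_cases)
  have "h < A" using Inp.prems(7) width_pos[of e] by simp
  have "nat \<lfloor>real k + real A\<rfloor> = A + k" "real k + real A \<in> \<nat>"
    by (metis add.commute floor_of_nat nat_int of_nat_add) simp
  then have "effects [Add h h 0, Load h h] R1 = Some (R1(h := inp k))"
    using inv R1(2) k \<open>h < A\<close> by (simp add: machine_inv_def)
  from exec_seq[OF R1(1) exec_effects[OF this]] show ?case
    unfolding computes_def using R1(3) k width_pos[of e]
    by (intro exI[of _ "R1(h := inp k)"]) auto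
next
  case (IfLe e1 e2 e3 e4)
  have 1: "computes (compile e1 h) (cost M e1) R h (width e1) (eval inp e1 env)"
    using IfLe.IH(1)[of env R h] IfLe.prems by simp
  have 2: "computes (compile e2 (h + 1)) (cost M e2) R' (h + 1) (width e2) (eval inp e2 env)"
    if "\<And>q. q < h \<or> h + width e1 \<le> q \<Longrightarrow> R' q = R q" for R'
    using IfLe.IH(2)[of env R' "h + 1"] IfLe.prems machine_inv_cong[of A inp R h "width e1" R'] that
    by simp
  obtain R' where R': "exec (compile e1 h ;; compile e2 (h + 1)) R (cost M e1 + cost M e2) R'"
      "R' h = eval inp e1 env" "R' (h + 1) = eval inp e2 env"
      "\<And>q. q < h \<or> h + max (width e1) (width e2 + 1) \<le> q \<Longrightarrow> R' q = R q"
    using computes_pair[OF 1 2] by blast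
  have inv: "machine_inv A inp R'"
    using IfLe.prems R'(4) machine_inv_cong[of A inp R h "max (width e1) (width e2 + 1)" R'] by simp
  have 3: "computes (compile e3 h) (cost M e3) R' h (width e3) (eval inp e3 env)"
    using IfLe.IH(3)[of env R' h] IfLe.prems inv R'(4) by simp
  have 4: "computes (compile e4 h) (cost M e4) R' h (width e4) (eval inp e4 env)"
    using IfLe.IH(4)[of env R' h] IfLe.prems inv R'(4) by simp
  let ?r = "eval inp (IfLe e1 e2 e3 e4) env"
  obtain R'' where R'': "if R' h \<le> R' (h + 1) then exec (compile e3 h) R' (cost M e3 + cost M e4) R''
        else exec (compile e4 h) R' (cost M e3 + cost M e4) R''"
      "R'' h = ?r" "\<And>q. q < h \<or> h + max (width e3) (width e4) \<le> q \<Longrightarrow> R'' q = R' q"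
  proof (cases "R' h \<le> R' (h + 1)")
    case True
    have "computes (compile e3 h) (cost M e3 + cost M e4) R' h (max (width e3) (width e4)) ?r"
      using computes_mono[OF 3] True R'(2,3) by simp
    then show ?thesis using True that unfolding computes_def by auto
  next
    case False
    have "computes (compile e4 h) (cost M e3 + cost M e4) R' h (max (width e3) (width e4)) ?r"
      using computes_mono[OF 4] False R'(2,3) by simp
    then show ?thesis using False that unfolding computes_def by auto
  qed
  show ?case
    unfolding computes_def
  proof (intro exI[of _ R''] conjI allI impI)
    show "exec (compile (IfLe e1 e2 e3 e4) h) R (cost M (IfLe e1 e2 e3 e4)) R''"
      using exec_seq[OF R'(1) exec_cond[OF R''(1)]] by (simp add: add.assoc)
  qed (use R''(2,3) R'(4) in auto)
next
  case (Iter a x b i e)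
  let ?w = "max (width i) (max (width b + 1) (width e + 4))"
  have 1: "computes (compile i h) (cost M i) R h (width i) (eval inp i env)"
    using Iter.IH(2)[of env R h] Iter.prems by simp
  have 2: "computes (compile b (h + 1)) (cost M b) R' (h + 1) (width b) (eval inp b env)"
    if "\<And>q. q < h \<or> h + width i \<le> q \<Longrightarrow> R' q = R q" for R'
    using Iter.IH(1)[of env R' "h + 1"] Iter.prems machine_inv_cong[of A inp R h "width i" R'] that
    by simp
  obtain R1 where R1: "exec (compile i h ;; compile b (h + 1)) R (cost M i + cost M b) R1"
      "R1 h = eval inp i env" "R1 (h + 1) = eval inp b env"
      "\<And>q. q < h \<or> h + max (width i) (width b + 1) \<le> q \<Longrightarrow> R1 q = R q"
    using computes_pair[OF 1 2] by blast
  have inv1: "machine_inv A inp R1"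
    using Iter.prems R1(4) machine_inv_cong[of A inp R h "max (width i) (width b + 1)" R1] by simp
  have ax: "3 \<le> a" "a < V" "3 \<le> x" "x < V" "a \<noteq> x" "V \<le> h" and wA: "h + ?w \<le> A"
    using Iter.prems by simp_all
  define val where "val = rec_nat (eval inp i env) (\<lambda>k acc. eval inp e (env(a := acc, x := real k)))"
  define N where "N = nat \<lceil>eval inp b env\<rceil>"
  define R2 where "R2 = R1(h + 2 := R1 a, h + 3 := R1 x, a := R1 h, x := 0)"
  have ex2: "exec (\<lambda>_. [Add (h + 2) a 2, Add (h + 3) x 2, Add a h 2, Const x 0]) R1 4 R2"
    by (rule exec_mono[OF exec_effects]) (use inv1 ax in \<open>simp_all add: machine_inv_def R2_def\<close>)
  let ?body = "compile e (h + 4) ;; (\<lambda>_. [Add a (h + 4) 2, Add x x 1])"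
  \<comment> \<open>Registers \<open>a\<close> and \<open>x\<close> are exempt from the frame clause
    because the body changes them; the saved copies restore them after the loop.\<close>
  define I where "I k S \<longleftrightarrow> S a = val k \<and> S x = real k \<and> S (h + 1) = eval inp b env \<and>
     S (h + 2) = R a \<and> S (h + 3) = R x \<and> (\<forall>q. q \<noteq> a \<longrightarrow> q \<noteq> x \<longrightarrow> q < h \<or> h + ?w \<le> q \<longrightarrow> S q = R q)" for k S
  have I0: "I 0 R2"
    unfolding I_def R2_def using ax R1 by (auto simp: val_def)
  have Istep: "\<not> S (h + 1) \<le> S x \<and> (\<exists>S'. exec ?body S (cost M e + 2) S' \<and> I (Suc k) S')"
    if "k < N" "I k S" for k S
  proof
    show "\<not> S (h + 1) \<le> S x"
      using that by (auto simp: I_def N_def) linarith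
    have inv: "machine_inv A inp S"
      using that(2) Iter.prems(3) ax wA by (auto simp: I_def machine_inv_def)
    have "computes (compile e (h + 4)) (cost M e) S (h + 4) (width e) (eval inp e (env(a := val k, x := real k)))"
    proof (rule Iter.IH(3))
      show "safe M inp e (env(a := val k, x := real k))"
        using Iter.prems(1) that(1) by (simp add: N_def val_def)
      show "S y = (env(a := val k, x := real k)) y" if "3 \<le> y" "y < V" for y
        using \<open>I k S\<close> that ax Iter.prems(4) by (auto simp: I_def)
    qed (use Iter.prems inv ax in auto)
    then obtain S1 where S1: "exec (compile e (h + 4)) S (cost M e) S1" "S1 (h + 4) = val (Suc k)"
        "\<And>q. q < h + 4 \<or> h + 4 + width e \<le> q \<Longrightarrow> S1 q = S q"
      unfolding computes_def val_def by auto
    have "machine_inv A inp S1"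
      using machine_inv_cong[OF inv S1(3)] ax wA by simp
    then have ex: "exec (\<lambda>_. [Add a (h + 4) 2, Add x x 1]) S1 2 (S1(a := val (Suc k), x := S x + 1))"
      by (intro exec_mono[OF exec_effects]) (use ax S1 in \<open>simp_all add: machine_inv_def\<close>)
    have "S1 q = S q" if "q < h \<or> h + ?w \<le> q" for q
      using that by (intro S1(3)) auto
    moreover have "S1 x = S x" "S1 (h + 1) = S (h + 1)" "S1 (h + 2) = S (h + 2)" "S1 (h + 3) = S (h + 3)"
      using ax by (auto intro!: S1(3))
    ultimately have "I (Suc k) (S1(a := val (Suc k), x := S x + 1))"
      using that(2) ax by (simp add: I_def)
    with exec_seq[OF S1(1) ex] show "\<exists>S'. exec ?body S (cost M e + 2) S' \<and> I (Suc k) S'"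
      by blast
  qed
  have Iexit: "S (h + 1) \<le> S x" if "I N S" for S
    using that by (auto simp: I_def N_def) linarith
  from exec_until[of N I, OF Istep Iexit I0]
  obtain R3 where R3: "exec (until (h + 1) x ?body) R2 (N * (cost M e + 2 + 2) + 1) R3" "I N R3"
    by auto
  have "machine_inv A inp R3"
    using R3(2) Iter.prems(3) ax wA by (auto simp: I_def machine_inv_def)
  then have ex4: "exec (\<lambda>_. [Add h a 2, Add a (h + 2) 2, Add x (h + 3) 2]) R3 3 (R3(h := val N, a := R a, x := R x))"
    by (intro exec_mono[OF exec_effects]) (use R3(2) ax in \<open>simp_all add: machine_inv_def I_def\<close>)
  have "N \<le> M" using Iter.prems(1) by (simp add: N_def)
  then have "N * (cost M e + 2 + 2) \<le> M * (cost M e + 4)" by (intro mult_le_mono) auto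
  then have "cost M i + cost M b + 4 + (N * (cost M e + 2 + 2) + 1) + 3 \<le> cost M (Iter a x b i e)"
    unfolding cost.simps by linarith
  from exec_mono[OF exec_seq[OF exec_seq[OF exec_seq[OF R1(1) ex2] R3(1)] ex4] this]
  have "exec (compile (Iter a x b i e) h) R (cost M (Iter a x b i e)) (R3(h := val N, a := R a, x := R x))"
    unfolding compile.simps .
  moreover have "val N = eval inp (Iter a x b i e) env"
    by (simp add: val_def N_def)
  ultimately show ?case
    unfolding computes_def using R3(2) ax
    by (intro exI[of _ "R3(h := val N, a := R a, x := R x)"]) (auto simp: I_def)
qed

text \<open>The equations of \<open>cost\<close> use only constants, \<open>M\<close>, sums and
  products, and functions bounded by some \<open>c * (M + 1) ^ k\<close> are closed under these. The
  base \<open>M + 1\<close> is at least 1, so exponents may be raised.\<close>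

lemma cost_polynomial: "\<exists>c k. \<forall>M. cost M e \<le> c * (M + 1) ^ k"
proof -
  define poly where "poly g \<longleftrightarrow> (\<exists>c k. \<forall>M. g M \<le> c * (M + 1) ^ k)" for g :: "nat \<Rightarrow> nat"
  have const: "poly (\<lambda>M. c)" for c
    unfolding poly_def by (rule exI[of _ c], rule exI[of _ 0]) simp
  have id: "poly (\<lambda>M. M)"
    unfolding poly_def by (rule exI[of _ 1], rule exI[of _ 1]) simp
  have add: "poly (\<lambda>M. g M + g' M)" if gg: "poly g" "poly g'" for g g'
  proof -
    obtain c k c' k' where *: "\<And>M. g M \<le> c * (M + 1) ^ k" "\<And>M. g' M \<le> c' * (M + 1) ^ k'"
      using gg unfolding poly_def by blast
    have "g M + g' M \<le> (c + c') * (M + 1) ^ (k + k')" for M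
    proof -
      have "c * (M + 1) ^ k \<le> c * (M + 1) ^ (k + k')" "c' * (M + 1) ^ k' \<le> c' * (M + 1) ^ (k + k')"
        by (intro mult_le_mono le_refl power_increasing; simp)+
      with *[of M] show ?thesis unfolding add_mult_distrib by linarith
    qed
    then show ?thesis unfolding poly_def by blast
  qed
  have mult: "poly (\<lambda>M. g M * g' M)" if gg: "poly g" "poly g'" for g g'
  proof -
    obtain c k c' k' where *: "\<And>M. g M \<le> c * (M + 1) ^ k" "\<And>M. g' M \<le> c' * (M + 1) ^ k'"
      using gg unfolding poly_def by blast
    have "g M * g' M \<le> (c * c') * (M + 1) ^ (k + k')" for M
      using mult_le_mono[OF *(1)[of M] *(2)[of M]] by (simp add: power_add algebra_simps)
    then show ?thesis unfolding poly_def by blast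
  qed
  have "poly (\<lambda>M. cost M e)"
    by (induction e) (simp_all only: cost.simps; intro add mult const id; assumption)+
  then show ?thesis by (simp add: poly_def)
qed

section \<open>Reduction to finitely many distance profiles\<close>

text \<open>All that a position of the target contributes at one voter is its distance
  \<open>r\<close>, so ranks become functions of a single real.\<close>

definition rank_at :: "nat \<Rightarrow> (nat \<Rightarrow> real) \<Rightarrow> real \<Rightarrow> nat \<Rightarrow> nat" where
  "rank_at n D r j =
     (if j = 0 then 1 + card {i. 1 \<le> i \<and> i < n \<and> D i < r}
      else 1 + card {i. 1 \<le> i \<and> i < n \<and> D i < D j} + (if r \<le> D j then 1 else 0))"

lemma rank_after_eq:
  "rank_after n d C V p v j = rank_at n (\<lambda>i. linf d (V v) (C i)) (linf d (V v) p) j"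
proof -
  have "{i. 1 \<le> i \<and> i < n \<and> i \<noteq> j \<and> linf d (V v) (C i) < linf d (V v) (C j)} =
        {i. 1 \<le> i \<and> i < n \<and> linf d (V v) (C i) < linf d (V v) (C j)}"
    by auto
  then show ?thesis by (simp add: rank_after_def rank_at_def)
qed

lemma rank_at_ge_1: "1 \<le> rank_at n D r j"
  by (simp add: rank_at_def)

text \<open>Needed because \<open>f\<close> is monotone only on ranks from 1 to \<open>n\<close>. At
  most \<open>n - 2\<close> other competitors precede a competitor, and the target may add one
  more.\<close>

lemma rank_at_le:
  assumes "j < n"
  shows "rank_at n D r j \<le> n"
proof (cases "j = 0")
  case True
  have "card {i. 1 \<le> i \<and> i < n \<and> D i < r} \<le> card {1..<n}"
    by (intro card_mono) auto
  then show ?thesis using True assms by (simp add: rank_at_def)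
next
  case False
  have "card {i. 1 \<le> i \<and> i < n \<and> D i < D j} \<le> card ({1..<n} - {j})"
    by (intro card_mono) auto
  also have "\<dots> = n - 2" using False assms by simp
  finally have "card {i. 1 \<le> i \<and> i < n \<and> D i < D j} \<le> n - 2" .
  moreover have "2 \<le> n" using False assms by simp
  ultimately have "card {i. 1 \<le> i \<and> i < n \<and> D i < D j} + 2 \<le> n" by linarith
  then show ?thesis using False by (simp add: rank_at_def)
qed

lemma rank_at_mono_target: "r \<le> r' \<Longrightarrow> rank_at n D r 0 \<le> rank_at n D r' 0"
  by (auto simp: rank_at_def intro!: card_mono)

lemma rank_at_antimono_other: "r \<le> r' \<Longrightarrow> 1 \<le> j \<Longrightarrow> rank_at n D r' j \<le> rank_at n D r j"
  by (auto simp: rank_at_def)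

text \<open>A rank sees \<open>r\<close> only through the comparisons with competitors' distances;
  this is what allows \<open>r\<close> to be rounded up to the next of them.\<close>

lemma rank_at_cong:
  assumes "\<And>i. 1 \<le> i \<Longrightarrow> i < n \<Longrightarrow> r \<le> D i \<longleftrightarrow> r' \<le> D i" "j < n"
  shows "rank_at n D r j = rank_at n D r' j"
proof -
  have "{i. 1 \<le> i \<and> i < n \<and> D i < r} = {i. 1 \<le> i \<and> i < n \<and> D i < r'}"
    using assms(1) by (auto simp: not_le[symmetric])
  then show ?thesis using assms by (auto simp: rank_at_def)
qed

section \<open>Intersections of balls, and rounding of distances to thresholds\<close>

lemma linf_le_iff:
  assumes "1 \<le> d"
  shows "linf d x y \<le> r \<longleftrightarrow> (\<forall>k<d. \<bar>x k - y k\<bar> \<le> r)"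
  unfolding linf_def using assms by (subst Max_le_iff) (auto simp: lessThan_empty_iff)

text \<open>Competitors start at 1, so index 0 is free for a bound that every admissible position
  meets by the triangle inequality. A profile entry is then exactly a digit in base
  \<open>n\<close>.\<close>

definition threshold :: "nat \<Rightarrow> real \<Rightarrow> (nat \<Rightarrow> nat \<Rightarrow> real) \<Rightarrow> (nat \<Rightarrow> nat \<Rightarrow> real) \<Rightarrow> nat \<Rightarrow> nat \<Rightarrow> real" where
  "threshold d eps C V v i = linf d (V v) (C i) + (if i = 0 then eps else 0)"

definition wins_at :: "nat \<Rightarrow> nat \<Rightarrow> nat \<Rightarrow> (nat \<Rightarrow> real) \<Rightarrow> (nat \<Rightarrow> nat \<Rightarrow> real) \<Rightarrow>
    (nat \<Rightarrow> nat \<Rightarrow> real) \<Rightarrow> (nat \<Rightarrow> real) \<Rightarrow> bool" where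
  "wins_at n m d f C V r \<longleftrightarrow> (\<forall>j. 1 \<le> j \<and> j < n \<longrightarrow>
     (\<Sum>v<m. f (rank_at n (\<lambda>i. linf d (V v) (C i)) (r v) j)) \<le>
     (\<Sum>v<m. f (rank_at n (\<lambda>i. linf d (V v) (C i)) (r v) 0)))"

text \<open>Helly's theorem on the line: finitely many intervals have a common point iff they meet
  pairwise. The case \<open>w = u\<close> says that \<open>r u\<close> is nonnegative; for the
  target's own interval this is \<open>0 \<le> eps\<close>.\<close>

definition boxes_meet :: "nat \<Rightarrow> nat \<Rightarrow> real \<Rightarrow> (nat \<Rightarrow> nat \<Rightarrow> real) \<Rightarrow>
    (nat \<Rightarrow> nat \<Rightarrow> real) \<Rightarrow> (nat \<Rightarrow> real) \<Rightarrow> bool" where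
  "boxes_meet m d eps C V r \<longleftrightarrow> (\<forall>k<d. \<forall>u<m.
     (C 0 k - eps \<le> V u k + r u \<and> V u k - r u \<le> C 0 k + eps) \<and>
     (\<forall>w<m. V u k - r u \<le> V w k + r w))"

lemma boxes_meet_iff:
  assumes "1 \<le> d" "0 \<le> eps"
  shows "boxes_meet m d eps C V r \<longleftrightarrow>
    (\<exists>p. linf d p (C 0) \<le> eps \<and> (\<forall>v<m. linf d (V v) p \<le> r v))"
proof
  assume *: "boxes_meet m d eps C V r"
  define L where "L k = insert (C 0 k - eps) ((\<lambda>v. V v k - r v) ` {..<m})" for k
  \<comment> \<open>The largest left end in each coordinate; the pairwise comparisons put it below
    every right end.\<close>
  define p where "p k = Max (L k)" for k
  have fin: "finite (L k)" "L k \<noteq> {}" for k by (auto simp: L_def)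
  have ge: "C 0 k - eps \<le> p k" "v < m \<Longrightarrow> V v k - r v \<le> p k" for k v
    unfolding p_def using fin[of k] by (auto intro!: Max_ge simp: L_def)
  have le: "p k \<le> C 0 k + eps" "v < m \<Longrightarrow> p k \<le> V v k + r v" if "k < d" for k v
    unfolding p_def using fin[of k] that * assms(2)
    by (auto simp: L_def boxes_meet_def Max_le_iff)
  have "linf d p (C 0) \<le> eps"
    unfolding linf_le_iff[OF assms(1)] abs_le_iff using ge(1) le(1) by (fastforce simp: algebra_simps)
  moreover have "linf d (V v) p \<le> r v" if "v < m" for v
    unfolding linf_le_iff[OF assms(1)] abs_le_iff using ge(2) le(2) that by (fastforce simp: algebra_simps)
  ultimately show "\<exists>p. linf d p (C 0) \<le> eps \<and> (\<forall>v<m. linf d (V v) p \<le> r v)" by blast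
next
  assume "\<exists>p. linf d p (C 0) \<le> eps \<and> (\<forall>v<m. linf d (V v) p \<le> r v)"
  then obtain p where p: "\<And>k. k < d \<Longrightarrow> \<bar>p k - C 0 k\<bar> \<le> eps"
      "\<And>v k. v < m \<Longrightarrow> k < d \<Longrightarrow> \<bar>V v k - p k\<bar> \<le> r v"
    unfolding linf_le_iff[OF assms(1)] by blast
  show "boxes_meet m d eps C V r"
    unfolding boxes_meet_def
  proof (intro allI impI conjI)
    fix k u assume k: "k < d" and u: "u < m"
    show "C 0 k - eps \<le> V u k + r u" "V u k - r u \<le> C 0 k + eps"
      using p(1)[OF k] p(2)[OF u k] by linarith+
    show "V u k - r u \<le> V w k + r w" if w: "w < m" for w
      using p(2)[OF u k] p(2)[OF w k] by linarith
  qed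
qed

text \<open>Moving the target closer to a voter never hurts it, so among all positions that fall between
  the same two competitors in a voter's ranking only the distance to the farther competitor matters.
  Index 0 stands for being ranked last: the bound \<^term>\<open>linf d (V v) (C 0) + eps\<close> holds anyway.\<close>

lemma constructive_control_iff_profile:
  assumes "valid_instance n m d eps f C V"
  shows "constructive_control n m d eps f C V \<longleftrightarrow>
    (\<exists>b. (\<forall>v<m. b v < n) \<and> boxes_meet m d eps C V (\<lambda>v. threshold d eps C V v (b v)) \<and>
         wins_at n m d f C V (\<lambda>v. threshold d eps C V v (b v)))"
proof -
  from assms have d: "1 \<le> d" and n: "1 \<le> n" and eps: "0 < eps"
    and f: "\<And>s t. 1 \<le> s \<Longrightarrow> s \<le> t \<Longrightarrow> t \<le> n \<Longrightarrow> f t \<le> f s"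
    by (auto simp: valid_instance_def)
  have cc: "constructive_control n m d eps f C V \<longleftrightarrow>
      (\<exists>p. linf d p (C 0) \<le> eps \<and> wins_at n m d f C V (\<lambda>v. linf d (V v) p))"
    by (simp add: constructive_control_def score_after_def rank_after_eq wins_at_def)
  show ?thesis
  proof
    assume "constructive_control n m d eps f C V"
    then obtain p where p: "linf d p (C 0) \<le> eps" and win: "wins_at n m d f C V (\<lambda>v. linf d (V v) p)"
      using cc by blast
    have "\<exists>i<n. linf d (V v) p \<le> threshold d eps C V v i \<and>
        (\<forall>j<n. linf d (V v) p \<le> threshold d eps C V v j \<longrightarrow>
               threshold d eps C V v i \<le> threshold d eps C V v j)" for v
    proof -
      \<comment> \<open>Indices whose threshold is at least the actual distance. Index 0 is among
        them; a minimal threshold in this set is the distance rounded up.\<close>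
      let ?S = "{i. i < n \<and> linf d (V v) p \<le> threshold d eps C V v i}"
      have "linf d (V v) p \<le> linf d (V v) (C 0) + eps"
        unfolding linf_le_iff[OF d]
      proof (intro allI impI)
        fix k assume k: "k < d"
        have "\<bar>p k - C 0 k\<bar> \<le> eps" "\<bar>V v k - C 0 k\<bar> \<le> linf d (V v) (C 0)"
          using p linf_le_iff[OF d, of p "C 0" eps] linf_le_iff[OF d, of "V v" "C 0" "linf d (V v) (C 0)"] k
          by auto
        then show "\<bar>V v k - p k\<bar> \<le> linf d (V v) (C 0) + eps" by linarith
      qed
      then have "0 \<in> ?S" using n by (simp add: threshold_def)
      then have "finite ?S" "?S \<noteq> {}" by auto
      from ex_is_arg_min_if_finite[OF this, of "threshold d eps C V v"]
      show ?thesis by (auto simp: is_arg_min_linorder)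
    qed
    then obtain b where b: "\<And>v. b v < n" "\<And>v. linf d (V v) p \<le> threshold d eps C V v (b v)"
      "\<And>v j. j < n \<Longrightarrow> linf d (V v) p \<le> threshold d eps C V v j \<Longrightarrow>
         threshold d eps C V v (b v) \<le> threshold d eps C V v j"
      by metis
    \<comment> \<open>Rounding up crosses no competitor: any \<open>i\<close> with distance at least
      that of \<open>p\<close> has its threshold in the set over which the minimum was
      taken.\<close>
    have eq: "rank_at n (\<lambda>i. linf d (V v) (C i)) (threshold d eps C V v (b v)) j =
        rank_at n (\<lambda>i. linf d (V v) (C i)) (linf d (V v) p) j" if "j < n" for v j
    proof (rule rank_at_cong[OF _ that])
      fix i :: nat assume "1 \<le> i" "i < n"
      then show "threshold d eps C V v (b v) \<le> linf d (V v) (C i) \<longleftrightarrow>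
          linf d (V v) p \<le> linf d (V v) (C i)"
        using b(2)[of v] b(3)[of i v] by (auto simp: threshold_def[of _ _ _ _ _ i])
    qed
    have "wins_at n m d f C V (\<lambda>v. threshold d eps C V v (b v))"
      using win n by (simp add: wins_at_def eq)
    moreover have "boxes_meet m d eps C V (\<lambda>v. threshold d eps C V v (b v))"
      using boxes_meet_iff[OF d, of eps] eps p b(2) by (metis less_imp_le)
    ultimately show "\<exists>b. (\<forall>v<m. b v < n) \<and>
        boxes_meet m d eps C V (\<lambda>v. threshold d eps C V v (b v)) \<and>
        wins_at n m d f C V (\<lambda>v. threshold d eps C V v (b v))"
      using b(1) by blast
  next
    assume "\<exists>b. (\<forall>v<m. b v < n) \<and> boxes_meet m d eps C V (\<lambda>v. threshold d eps C V v (b v)) \<and>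
        wins_at n m d f C V (\<lambda>v. threshold d eps C V v (b v))"
    then obtain r where "boxes_meet m d eps C V r" and win: "wins_at n m d f C V r"
      by blast
    then obtain p where p: "linf d p (C 0) \<le> eps" "\<And>v. v < m \<Longrightarrow> linf d (V v) p \<le> r v"
      using boxes_meet_iff[OF d, of eps m C V r] eps by auto
    \<comment> \<open>\<open>r\<close> only bounds the distances to \<open>p\<close>. Passing to the
      distances themselves lowers every competitor's total and raises the target's, so the
      inequality survives.\<close>
    have "wins_at n m d f C V (\<lambda>v. linf d (V v) p)"
      unfolding wins_at_def
    proof (intro allI impI)
      fix j assume j: "1 \<le> j \<and> j < n"
      let ?rk = "\<lambda>r v. rank_at n (\<lambda>i. linf d (V v) (C i)) (r v)"
      let ?l = "\<lambda>v. linf d (V v) p"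
      have "(\<Sum>v<m. f (?rk ?l v j)) \<le> (\<Sum>v<m. f (?rk r v j))"
        using p(2) j by (intro sum_mono f rank_at_ge_1 rank_at_le rank_at_antimono_other) auto
      also have "\<dots> \<le> (\<Sum>v<m. f (?rk r v 0))"
        using win j by (simp add: wins_at_def)
      also have "\<dots> \<le> (\<Sum>v<m. f (?rk ?l v 0))"
        using p(2) n by (intro sum_mono f rank_at_ge_1 rank_at_le rank_at_mono_target) auto
      finally show "(\<Sum>v<m. f (?rk ?l v j)) \<le> (\<Sum>v<m. f (?rk ?l v 0))" .
    qed
    then show "constructive_control n m d eps f C V"
      using cc p(1) by blast
  qed
qed

text \<open>The induction puts the digit \<open>b m\<close> in front: \<open>b m * n ^ m\<close> is
  a multiple of \<open>n ^ Suc v\<close> for \<open>v < m\<close>, so it leaves the lower digits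
  alone.\<close>

lemma digits_surjective:
  fixes n :: nat
  assumes "\<forall>v<m. b v < n"
  shows "\<exists>x<n ^ m. \<forall>v<m. x div n ^ v mod n = b v"
  using assms
proof (induction m)
  case 0
  then show ?case by simp
next
  case (Suc m)
  then obtain x where x: "x < n ^ m" "\<forall>v<m. x div n ^ v mod n = b v" by auto
  have bm: "b m < n" using Suc.prems by simp
  let ?y = "x + b m * n ^ m"
  have "?y < n ^ m + b m * n ^ m" using x(1) by simp
  also have "\<dots> = (b m + 1) * n ^ m" by simp
  also have "\<dots> \<le> n * n ^ m" using bm by (intro mult_right_mono) auto
  finally have "?y < n ^ Suc m" by simp
  moreover have "?y div n ^ v mod n = b v" if "v < Suc m" for v
  proof (cases "v = m")
    case True
    then show ?thesis using x(1) bm by (simp add: div_mult_self3)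
  next
    case False
    with that have "v < m" by simp
    then have "n ^ m = n ^ v * (n * n ^ (m - v - 1))"
      by (metis Suc_diff_Suc diff_Suc_eq_diff_pred add_diff_inverse_nat less_imp_add_positive not_less_iff_gr_or_eq power_Suc power_add diff_diff_left plus_1_eq_Suc add.commute)
    then have "?y div n ^ v = x div n ^ v + b m * (n * n ^ (m - v - 1))"
      using bm by (simp add: mult.left_commute[of "b m"])
    then show ?thesis using x(2) \<open>v < m\<close> by (simp add: mult.left_commute[of "b m" n])
  qed
  ultimately show ?case by blast
qed

section \<open>Relocating the input\<close>

text \<open>The input fills the low registers, so the first free address has to be computed in place.
  With \<open>n\<close>, \<open>m\<close>, \<open>d\<close> in registers 0, 1, 2, register 1 receives \<open>1024 (n + (n + m) d)\<close>, which lies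
  beyond the input and from which \<open>m\<close> can be recovered.\<close>

definition relocate_base :: "instr list" where
  "relocate_base = [Add 1 0 1, Mul 1 1 2, Add 1 1 0] @ replicate 10 (Add 1 1 1)"

text \<open>Addresses need a register, and none is free: cell \<open>A\<close> first parks register
  3, which then serves as address register. Once register 2 is stored at \<open>A + 2\<close>, it
  carries the parked value to \<open>A + 3\<close>, and \<open>n\<close> takes its place in
  \<open>A\<close>. Cell \<open>A + 1\<close> waits until \<open>m\<close> is recovered.\<close>

definition relocate_low :: "instr list" where
  "relocate_low =
    [Store 3 1, Const 3 2, Add 3 3 1, Store 2 3, Load 2 1] @
    [Const 3 3, Add 3 3 1, Store 2 3, Store 0 1] @
    [Const 3 4, Add 3 3 1, Store 4 3, Const 3 5, Add 3 3 1, Store 5 3]"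

text \<open>\<open>A / 1024 = n + (n + m) * d\<close> yields \<open>m\<close> by subtracting
  \<open>n\<close>, dividing by \<open>d\<close> and subtracting \<open>n\<close> again; adding 4 to
  it gives the input length. The copying loop starts at 6, as cells 0 to 5 have been moved by
  hand.\<close>

definition relocate_sizes :: "instr list" where
  "relocate_sizes =
    [Const 3 2, Add 3 3 1, Load 2 3, Const 3 1024, Div 4 1 3, Sub 5 4 0, Div 5 5 2, Sub 5 5 0,
     Const 3 1, Add 3 3 1, Store 5 3, Const 3 4, Add 5 4 3, Const 0 1, Const 2 6]"

definition relocate :: code where
  "relocate = (\<lambda>_. relocate_base) ;; (\<lambda>_. relocate_low) ;; (\<lambda>_. relocate_sizes) ;;
     until 5 2 (\<lambda>_. [Add 3 1 2, Load 4 2, Store 4 3, Add 2 2 0]) ;;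
     (\<lambda>_. [Const 2 0, Add 0 1 2, Const 1 1])"

text \<open>Since \<open>L \<le> A\<close>, source and destination are disjoint, and the cells from
  \<open>A\<close> on are initially 0. Copying \<open>L\<close> cells therefore makes the copy agree
  with \<open>inp\<close> at all indices, also past the end of the input.\<close>

lemma relocate_correct:
  fixes n m d :: nat and inp :: regs
  assumes nd: "1 \<le> n" "1 \<le> d"
    and L: "L = 4 + n + (n + m) * d"
    and inp: "inp 0 = real n" "inp 1 = real m" "inp 2 = real d" "\<And>i. L \<le> i \<Longrightarrow> inp i = 0"
    and A: "A = 1024 * (n + (n + m) * d)"
  shows "\<exists>R. exec relocate inp (50 * (L + 1)) R \<and> machine_inv A inp R"
proof -
  define X where "X = n + (n + m) * d"
  have "1 * 1 \<le> (n + m) * d" using nd by (intro mult_le_mono) auto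
  with nd have "2 \<le> X" unfolding X_def by linarith
  moreover have "L = 4 + X" "A = 1024 * X" by (simp_all add: L A X_def)
  ultimately have A_ge: "2048 \<le> A" "L \<le> A" "6 \<le> L" by simp_all
  have zero: "inp (A + i) = 0" for i using inp(4) A_ge by simp
  have double: "effects (replicate q (Add 1 1 1)) (R(1 := r)) = Some (R(1 := 2 ^ q * r))"
    for q r and R :: regs
    by (induction q arbitrary: r) (simp_all add: algebra_simps)
  have base: "effects relocate_base inp = Some (inp(1 := real A))"
    using inp(1-3) double[of 10 inp "real n + (real n + real m) * real d"]
    by (simp add: relocate_base_def A algebra_simps)
  have nat_floor: "nat (numeral w + int A) = A + numeral w" "nat (1 + int A) = A + 1" for w
    by (simp_all add: nat_add_distrib)
  have X: "real A / 1024 = real n + (real n + real m) * real d" by (simp add: A)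
  have low: "R (A + i) = inp i" if "R A = inp 0" "R (A + 1) = inp 1" "R (A + 2) = inp 2"
      "R (A + 3) = inp 3" "R (A + 4) = inp 4" "R (A + 5) = inp 5" "i < 6" for R i
    using that by (auto simp: numeral_eq_Suc less_Suc_eq)
  define Ra where "Ra = inp(1 := real A, A := inp 3, A + 2 := inp 2, 3 := 2 + real A, 2 := inp 3)"
  define Rb where "Rb = Ra(3 := 3 + real A, A + 3 := inp 3, A := inp 0)"
  define R0 where "R0 = Rb(3 := 5 + real A, A + 4 := inp 4, A + 5 := inp 5)"
  have a: "effects [Store 3 1, Const 3 2, Add 3 3 1, Store 2 3, Load 2 1] (inp(1 := real A)) = Some Ra"
    using A_ge(1) by (simp add: nat_floor Ra_def fun_eq_iff)
  have Ra: "Ra 0 = inp 0" "Ra 1 = real A" "Ra 2 = inp 3" "Ra 4 = inp 4" "Ra 5 = inp 5"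
    using A_ge(1) by (simp_all add: Ra_def)
  have b: "effects [Const 3 3, Add 3 3 1, Store 2 3, Store 0 1] Ra = Some Rb"
    using A_ge(1) Ra by (simp add: nat_floor Rb_def fun_eq_iff)
  have Rb: "Rb 1 = real A" "Rb 4 = inp 4" "Rb 5 = inp 5"
    using A_ge(1) Ra by (simp_all add: Rb_def)
  have c: "effects [Const 3 4, Add 3 3 1, Store 4 3, Const 3 5, Add 3 3 1, Store 5 3] Rb = Some R0"
    using A_ge(1) Rb by (simp add: nat_floor R0_def fun_eq_iff)
  have eff0: "effects relocate_low (inp(1 := real A)) = Some R0"
    by (simp only: relocate_low_def effects_append a b c Option.bind.simps)
  have R0: "R0 0 = real n" "R0 1 = real A" "R0 A = inp 0" "R0 (A + 2) = real d"
      "R0 (A + 3) = inp 3" "R0 (A + 4) = inp 4" "R0 (A + 5) = inp 5"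
    using A_ge(1) inp(1,3) by (simp_all add: R0_def Rb_def Ra_def)
  have R0_high: "R0 (A + i) = 0" "i < A \<Longrightarrow> R0 i = inp i" if "6 \<le> i" for i
    using A_ge(1) zero[of i] that by (simp_all add: R0_def Rb_def Ra_def)
  define R where "R = R0(2 := 6, 3 := 4, 4 := real n + (real n + real m) * real d, A + 1 := real m,
      5 := real L, 0 := 1)"
  have "effects relocate_sizes R0 = Some R"
    using A_ge(1) R0(1,2,4) nd
    by (simp add: relocate_sizes_def nat_floor X R_def L fun_eq_iff)
  note eff = this
  have R: "R 0 = 1" "R 1 = real A" "R 2 = 6" "R 5 = real L"
      "\<And>i. 6 \<le> i \<Longrightarrow> R (A + i) = 0" "\<And>i. 6 \<le> i \<Longrightarrow> i < A \<Longrightarrow> R i = inp i"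
    using A_ge(1) R0 R0_high by (simp_all add: R_def)
  have R': "R (A + i) = inp i" if "i < 6" for i
    by (rule low) (use A_ge(1) R0 inp that in \<open>simp_all add: R_def\<close>)
  \<comment> \<open>The last clause keeps the source cells intact; cells below 6 have become working
    registers.\<close>
  define I where "I k S \<longleftrightarrow> S 0 = 1 \<and> S 1 = real A \<and> S 2 = real (6 + k) \<and> S 5 = real L \<and>
     (\<forall>i<6 + k. S (A + i) = inp i) \<and> (\<forall>i\<ge>6 + k. S (A + i) = 0) \<and>
     (\<forall>i. 6 \<le> i \<longrightarrow> i < A \<longrightarrow> S i = inp i)" for k and S :: regs
  let ?body = "[Add 3 1 2, Load 4 2, Store 4 3, Add 2 2 0]"
  have step: "\<not> S 5 \<le> S 2 \<and> (\<exists>S'. exec (\<lambda>_. ?body) S 4 S' \<and> I (Suc k) S')"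
    if "k < L - 6" "I k S" for k S
  proof
    show "\<not> S 5 \<le> S 2" using that by (simp add: I_def)
    have k: "6 + k < A" using that(1) A_ge by simp
    have "nat \<lfloor>real A + real (6 + k)\<rfloor> = A + (6 + k)" "real A + real (6 + k) \<in> \<nat>"
      by (metis floor_of_nat nat_int of_nat_add) simp
    moreover have "nat \<lfloor>real (6 + k)\<rfloor> = 6 + k" by (simp only: floor_of_nat nat_int)
    ultimately have "effects ?body S =
        Some (S(3 := real A + real (6 + k), 4 := inp (6 + k), A + (6 + k) := inp (6 + k), 2 := real (6 + Suc k)))"
      using that(2) k unfolding I_def by (simp add: fun_upd_twist)
    then have "exec (\<lambda>_. ?body) S 4
        (S(3 := real A + real (6 + k), 4 := inp (6 + k), A + (6 + k) := inp (6 + k), 2 := real (6 + Suc k)))"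
      by (intro exec_mono[OF exec_effects]) auto
    moreover have "I (Suc k) (S(3 := real A + real (6 + k), 4 := inp (6 + k), A + (6 + k) := inp (6 + k), 2 := real (6 + Suc k)))"
      using that(2) A_ge unfolding I_def by (auto simp: less_Suc_eq)
    ultimately show "\<exists>S'. exec (\<lambda>_. ?body) S 4 S' \<and> I (Suc k) S'" by blast
  qed
  have exit: "S 5 \<le> S 2" if "I (L - 6) S" for S
    using that A_ge by (simp add: I_def)
  have "I 0 R" using R R' by (simp add: I_def)
  from exec_until[of "L - 6" I, OF step exit this]
  obtain S where S: "exec (until 5 2 (\<lambda>_. ?body)) R ((L - 6) * (4 + 2) + 1) S" "I (L - 6) S"
    by blast
  have "S (A + i) = inp i" for i
    using S(2) inp(4)[of i] A_ge by (cases "i < L") (auto simp: I_def)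
  then have inv: "machine_inv A inp (S(2 := 0, 0 := S 1, 1 := 1))"
    using S(2) A_ge by (auto simp: machine_inv_def I_def)
  have "exec (\<lambda>_. [Const 2 0, Add 0 1 2, Const 1 1]) S 3 (S(2 := 0, 0 := S 1, 1 := 1))"
    by (intro exec_mono[OF exec_effects]) auto
  from exec_seq[OF exec_seq[OF exec_seq[OF exec_seq[OF exec_effects[OF base] exec_effects[OF eff0]] exec_effects[OF eff]] S(1)] this]
  have "exec relocate inp (50 * (L + 1)) (S(2 := 0, 0 := S 1, 1 := 1))"
    unfolding relocate_def
    by (rule exec_mono) (use A_ge in \<open>simp add: relocate_base_def relocate_low_def relocate_sizes_def\<close>)
  with inv show ?thesis by blast
qed

section \<open>The decision procedure as an expression\<close>

text \<open>Describing the running maximum by its upper bounds reduces its equality with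
  \<open>MAX\<close> to antisymmetry.\<close>

lemma rec_nat_max_le_iff:
  "rec_nat 0 (\<lambda>k acc. if acc \<le> g k then g k else acc) N \<le> (t::real) \<longleftrightarrow> 0 \<le> t \<and> (\<forall>k<N. g k \<le> t)"
  by (induction N) (auto simp: less_Suc_eq)

text \<open>Variable 3 is the accumulator of all sums, products and maxima; it may be shadowed freely
  because their bodies do not mention it.\<close>

definition sumE :: "nat \<Rightarrow> exp \<Rightarrow> exp \<Rightarrow> exp" where
  "sumE x b e = Iter 3 x b (Num 0) (Plus (Var 3) e)"

definition prodE :: "nat \<Rightarrow> exp \<Rightarrow> exp \<Rightarrow> exp" where
  "prodE x b e = Iter 3 x b (Num 1) (Times (Var 3) e)"

definition maxE :: "nat \<Rightarrow> exp \<Rightarrow> exp \<Rightarrow> exp" where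
  "maxE x b e = Iter 3 x b (Num 0) (IfLe (Var 3) e e (Var 3))"

text \<open>A local binding as a loop of one round: the accumulator \<open>x\<close> starts with the
  value of \<open>e\<close>, and the round returns \<open>e'\<close>. Variable 12 is a dummy
  counter.\<close>

definition letE :: "nat \<Rightarrow> exp \<Rightarrow> exp \<Rightarrow> exp" where
  "letE x e e' = Iter x 12 (Num 1) e e'"

definition leE :: "exp \<Rightarrow> exp \<Rightarrow> exp" where
  "leE e e' = IfLe e e' (Num 1) (Num 0)"

definition nE :: exp where "nE = Inp (Num 0)"
definition mE :: exp where "mE = Inp (Num 1)"
definition dE :: exp where "dE = Inp (Num 2)"
definition epsE :: exp where "epsE = Inp (Num 3)"

definition fE :: "exp \<Rightarrow> exp" where
  "fE t = Inp (Plus (Num 3) t)"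

definition candE :: "exp \<Rightarrow> exp \<Rightarrow> exp" where
  "candE i k = Inp (Plus (Plus (Num 4) nE) (Plus (Times i dE) k))"

definition voterE :: "exp \<Rightarrow> exp \<Rightarrow> exp" where
  "voterE v k = Inp (Plus (Plus (Num 4) nE) (Plus (Times nE dE) (Plus (Times v dE) k)))"

definition distE :: "nat \<Rightarrow> nat \<Rightarrow> exp" where
  "distE v i = maxE 4 dE
     (IfLe (voterE (Var v) (Var 4)) (candE (Var i) (Var 4))
        (Minus (candE (Var i) (Var 4)) (voterE (Var v) (Var 4)))
        (Minus (voterE (Var v) (Var 4)) (candE (Var i) (Var 4))))"

definition powE :: "exp \<Rightarrow> exp" where
  "powE e = prodE 10 e nE"

text \<open>Variable 8 holds the code \<open>x < n ^ m\<close> of the profile whose entry for voter \<open>v\<close> is the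
  \<open>v\<close>-th digit of \<open>x\<close> in base \<open>n\<close>.\<close>

definition quotE :: "exp \<Rightarrow> exp" where
  "quotE e = sumE 9 (powE mE) (leE (Times (Plus (Var 9) (Num 1)) (powE e)) (Var 8))"

definition digitE :: "nat \<Rightarrow> exp" where
  "digitE v = Minus (quotE (Var v)) (Times nE (quotE (Plus (Var v) (Num 1))))"

definition thresholdE :: "nat \<Rightarrow> exp" where
  "thresholdE v = letE 11 (digitE v) (Plus (distE v 11) (IfLe (Var 11) (Num 0) epsE (Num 0)))"

definition rankE :: "nat \<Rightarrow> nat \<Rightarrow> exp" where
  "rankE v j = Plus (Plus (Num 1)
       (sumE 5 nE (IfLe (Num 1) (Var 5)
          (IfLe (IfLe (Var j) (Num 0) (thresholdE v) (distE v j)) (distE v 5) (Num 0) (Num 1))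
          (Num 0))))
     (IfLe (Num 1) (Var j) (leE (thresholdE v) (distE v j)) (Num 0))"

definition scoreE :: "nat \<Rightarrow> exp" where
  "scoreE j = sumE 6 mE (fE (rankE 6 j))"

text \<open>\<open>scoreE\<close> expects a variable that holds the candidate, hence 13 is bound to
  0. The factor for candidate 0 compares the target with itself and is 1.\<close>

definition winsE :: exp where
  "winsE = letE 13 (Num 0) (prodE 7 nE (leE (scoreE 7) (scoreE 13)))"

definition boxesE :: exp where
  "boxesE = prodE 15 dE (prodE 6 mE (Times
     (Times (leE (Minus (candE (Num 0) (Var 15)) epsE) (Plus (voterE (Var 6) (Var 15)) (thresholdE 6)))
            (leE (Minus (voterE (Var 6) (Var 15)) (thresholdE 6)) (Plus (candE (Num 0) (Var 15)) epsE)))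
     (prodE 14 mE (leE (Minus (voterE (Var 6) (Var 15)) (thresholdE 6))
                       (Plus (voterE (Var 14) (Var 15)) (thresholdE 14))))))"

text \<open>Existence of a good profile as a count that is at least 1.\<close>

definition controlE :: exp where
  "controlE = leE (Num 1) (sumE 8 (powE mE) (Times boxesE winsE))"

lemma controlE_wf: "wf_exp 16 controlE"
  by (simp add: controlE_def boxesE_def winsE_def scoreE_def rankE_def thresholdE_def digitE_def
      quotE_def powE_def distE_def voterE_def candE_def fE_def epsE_def dE_def mE_def nE_def leE_def
      letE_def maxE_def prodE_def sumE_def)

text \<open>With temporaries starting at register 16, the bound keeps them below 2016 and so below
  \<open>A\<close>.\<close>

lemma controlE_width: "width controlE \<le> 2000"
  by (simp add: controlE_def boxesE_def winsE_def scoreE_def rankE_def thresholdE_def digitE_def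
      quotE_def powE_def distE_def voterE_def candE_def fE_def epsE_def dE_def mE_def nE_def leE_def
      letE_def maxE_def prodE_def sumE_def)

section \<open>Meaning of the expressions on an encoded instance\<close>

locale election_input =
  fixes n m d :: nat and eps :: real and f :: "nat \<Rightarrow> real" and C V :: "nat \<Rightarrow> nat \<Rightarrow> real"
    and inp :: regs and M :: nat
  assumes n_pos: "1 \<le> n" and d_pos: "1 \<le> d"
    and inp_n: "inp 0 = real n" and inp_m: "inp 1 = real m" and inp_d: "inp 2 = real d"
    and inp_eps: "inp 3 = eps"
    and inp_f: "\<And>t. 1 \<le> t \<Longrightarrow> t \<le> n \<Longrightarrow> inp (3 + t) = f t"
    and inp_C: "\<And>i k. i < n \<Longrightarrow> k < d \<Longrightarrow> inp (4 + n + (i * d + k)) = C i k"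
    and inp_V: "\<And>v k. v < m \<Longrightarrow> k < d \<Longrightarrow> inp (4 + n + (n * d + (v * d + k))) = V v k"
    and M_ge: "n \<le> M" "m \<le> M" "d \<le> M" "n ^ m \<le> M" "1 \<le> M"
begin

text \<open>Safety and value are proved together, so that each syntactic construct gets one
  introduction rule.\<close>

definition denotes :: "exp \<Rightarrow> regs \<Rightarrow> real \<Rightarrow> bool" where
  "denotes e env r \<longleftrightarrow> safe M inp e env \<and> eval inp e env = r"

lemma denotes_Num: "denotes (Num r) env r"
  by (simp add: denotes_def)

lemma denotes_Var: "env x = r \<Longrightarrow> denotes (Var x) env r"
  by (simp add: denotes_def)

lemma denotes_Plus: "denotes e env r \<Longrightarrow> denotes e' env r' \<Longrightarrow> denotes (Plus e e') env (r + r')"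
  by (simp add: denotes_def)

lemma denotes_Minus: "denotes e env r \<Longrightarrow> denotes e' env r' \<Longrightarrow> denotes (Minus e e') env (r - r')"
  by (simp add: denotes_def)

lemma denotes_Times: "denotes e env r \<Longrightarrow> denotes e' env r' \<Longrightarrow> denotes (Times e e') env (r * r')"
  by (simp add: denotes_def)

lemma denotes_Inp: "denotes e env r \<Longrightarrow> r = real k \<Longrightarrow> denotes (Inp e) env (inp k)"
  by (simp add: denotes_def)

lemma denotes_IfLe:
  "denotes e1 env r1 \<Longrightarrow> denotes e2 env r2 \<Longrightarrow> denotes e3 env r3 \<Longrightarrow> denotes e4 env r4 \<Longrightarrow>
   denotes (IfLe e1 e2 e3 e4) env (if r1 \<le> r2 then r3 else r4)"
  by (simp add: denotes_def)

lemma denotes_leE: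
  "denotes e env r \<Longrightarrow> denotes e' env r' \<Longrightarrow> denotes (leE e e') env (of_bool (r \<le> r'))"
  by (simp add: denotes_def leE_def)

lemmas denotes_intros = denotes_Num denotes_Var denotes_Plus denotes_Minus denotes_Times
  denotes_IfLe denotes_leE

lemma denotes_eq: "denotes e env r \<Longrightarrow> r = r' \<Longrightarrow> denotes e env r'"
  by simp

text \<open>Asking for the value of the body under every \<open>acc\<close> expresses that it is
  insensitive to variable 3, which nested loops may thus reuse.\<close>

lemma denotes_sumE:
  assumes "denotes b env (real N)" "N \<le> M" "x \<noteq> 3"
    and e: "\<And>acc k. k < N \<Longrightarrow> denotes e (env(3 := acc, x := real k)) (g k)"
  shows "denotes (sumE x b e) env (\<Sum>k<N. g k)"
proof -
  have "rec_nat 0 (\<lambda>k acc. (env(3 := acc, x := real k)) 3 + eval inp e (env(3 := acc, x := real k))) K =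
      (\<Sum>k<K. g k)" if "K \<le> N" for K
    using that by (induction K) (use e assms(3) in \<open>auto simp: denotes_def\<close>)
  from this[of N] show ?thesis
    using assms by (auto simp: denotes_def sumE_def)
qed

lemma denotes_prodE:
  assumes "denotes b env (real N)" "N \<le> M" "x \<noteq> 3"
    and e: "\<And>acc k. k < N \<Longrightarrow> denotes e (env(3 := acc, x := real k)) (g k)"
  shows "denotes (prodE x b e) env (\<Prod>k<N. g k)"
proof -
  have "rec_nat 1 (\<lambda>k acc. (env(3 := acc, x := real k)) 3 * eval inp e (env(3 := acc, x := real k))) K =
      (\<Prod>k<K. g k)" if "K \<le> N" for K
    using that by (induction K) (use e assms(3) in \<open>auto simp: denotes_def\<close>)
  from this[of N] show ?thesis
    using assms by (auto simp: denotes_def prodE_def)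
qed

text \<open>A product of truth values 0 and 1 serves as bounded universal quantifier.\<close>

lemma denotes_prodE_of_bool:
  assumes "denotes b env (real N)" "N \<le> M" "x \<noteq> 3"
    and e: "\<And>acc k. k < N \<Longrightarrow> denotes e (env(3 := acc, x := real k)) (of_bool (Q k))"
  shows "denotes (prodE x b e) env (of_bool (\<forall>k<N. Q k))"
proof (rule denotes_eq[OF denotes_prodE[OF assms]])
  show "(\<Prod>k<N. of_bool (Q k)) = (of_bool (\<forall>k<N. Q k) :: real)"
    by (induction N) (auto simp: less_Suc_eq)
qed

lemma denotes_maxE:
  assumes "denotes b env (real N)" "N \<le> M" "x \<noteq> 3" "1 \<le> N"
    and e: "\<And>acc k. k < N \<Longrightarrow> denotes e (env(3 := acc, x := real k)) (g k)"
    and g: "\<And>k. k < N \<Longrightarrow> 0 \<le> g k"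
  shows "denotes (maxE x b e) env (MAX k\<in>{..<N}. g k)"
proof -
  let ?r = "rec_nat 0 (\<lambda>k acc. if acc \<le> g k then g k else acc)"
  have "rec_nat 0 (\<lambda>k acc. if (env(3 := acc, x := real k)) 3 \<le> eval inp e (env(3 := acc, x := real k))
      then eval inp e (env(3 := acc, x := real k)) else eval inp (Var 3) (env(3 := acc, x := real k))) K = ?r K"
    if "K \<le> N" for K
    using that by (induction K) (use e assms(3) in \<open>auto simp: denotes_def\<close>)
  from this[of N] have "denotes (maxE x b e) env (?r N)"
    using assms by (auto simp: denotes_def maxE_def)
  \<comment> \<open>The start value 0 does not disturb the maximum, because the terms are
    nonnegative and there is at least one.\<close>
  moreover have iff: "?r N \<le> t \<longleftrightarrow> (MAX k\<in>{..<N}. g k) \<le> t" for t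
    unfolding rec_nat_max_le_iff using assms(4) g
    by (subst Max_le_iff) (auto simp: lessThan_empty_iff intro: order_trans[OF g[of 0]])
  have "?r N = (MAX k\<in>{..<N}. g k)"
  proof (rule order_antisym)
    show "?r N \<le> (MAX k\<in>{..<N}. g k)" unfolding iff ..
    show "(MAX k\<in>{..<N}. g k) \<le> ?r N" unfolding iff[symmetric] ..
  qed
  ultimately show ?thesis by simp
qed

lemma denotes_letE:
  assumes "denotes e env r" "denotes e' (env(x := r, 12 := 0)) r'"
  shows "denotes (letE x e e') env r'"
  using assms M_ge by (auto simp: denotes_def letE_def)

lemma denotes_nE: "denotes nE env (real n)"
  unfolding nE_def inp_n[symmetric] by (rule denotes_Inp[OF denotes_Num]) simp

lemma denotes_mE: "denotes mE env (real m)"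
  unfolding mE_def inp_m[symmetric] by (rule denotes_Inp[OF denotes_Num]) simp

lemma denotes_dE: "denotes dE env (real d)"
  unfolding dE_def inp_d[symmetric] by (rule denotes_Inp[OF denotes_Num]) simp

lemma denotes_epsE: "denotes epsE env eps"
  unfolding epsE_def inp_eps[symmetric] by (rule denotes_Inp[OF denotes_Num]) simp

lemma denotes_fE:
  assumes "denotes e env (real t)" "1 \<le> t" "t \<le> n"
  shows "denotes (fE e) env (f t)"
  unfolding fE_def inp_f[OF assms(2,3), symmetric]
  by (rule denotes_Inp[OF denotes_Plus[OF denotes_Num assms(1)]]) simp

lemma denotes_candE:
  assumes "denotes e env (real i)" "denotes e' env (real k)" "i < n" "k < d"
  shows "denotes (candE e e') env (C i k)"
  unfolding candE_def inp_C[OF assms(3,4), symmetric]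
  by (rule denotes_Inp, (rule denotes_intros assms denotes_nE denotes_dE)+) simp

lemma denotes_voterE:
  assumes "denotes e env (real v)" "denotes e' env (real k)" "v < m" "k < d"
  shows "denotes (voterE e e') env (V v k)"
  unfolding voterE_def inp_V[OF assms(3,4), symmetric]
  by (rule denotes_Inp, (rule denotes_intros assms denotes_nE denotes_dE)+) simp

lemma denotes_distE:
  assumes "env x = real v" "env y = real i" "v < m" "i < n" "x \<notin> {3, 4}" "y \<notin> {3, 4}"
  shows "denotes (distE x y) env (linf d (V v) (C i))"
  unfolding distE_def linf_def
proof (rule denotes_maxE[OF denotes_dE])
  fix acc k assume k: "k < d"
  let ?env = "env(3 := acc, 4 := real k)"
  have v: "denotes (voterE (Var x) (Var 4)) ?env (V v k)"
    using assms k by (intro denotes_voterE denotes_Var) auto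
  have c: "denotes (candE (Var y) (Var 4)) ?env (C i k)"
    using assms k by (intro denotes_candE denotes_Var) auto
  show "denotes (IfLe (voterE (Var x) (Var 4)) (candE (Var y) (Var 4))
        (Minus (candE (Var y) (Var 4)) (voterE (Var x) (Var 4)))
        (Minus (voterE (Var x) (Var 4)) (candE (Var y) (Var 4)))) ?env \<bar>V v k - C i k\<bar>"
    by (rule denotes_eq[OF denotes_IfLe[OF v c denotes_Minus[OF c v] denotes_Minus[OF v c]]]) auto
qed (use M_ge d_pos in auto)

lemma denotes_powE:
  assumes "denotes e env (real k)" "k \<le> M"
  shows "denotes (powE e) env (real (n ^ k))"
  unfolding powE_def
  by (rule denotes_eq[OF denotes_prodE[OF assms _ denotes_nE]]) simp_all

text \<open>Integer division by counting: \<open>(k + 1) * n ^ w \<le> x\<close> holds for exactly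
  the \<open>k\<close> below \<open>x div n ^ w\<close>, and \<open>x < n ^ m\<close> makes the
  range of the sum long enough.\<close>

lemma denotes_quotE:
  assumes "env 8 = real x" "x < n ^ m" "w \<le> M"
    and e: "\<And>acc k. denotes e (env(3 := acc, 9 := k)) (real w)"
  shows "denotes (quotE e) env (real (x div n ^ w))"
  unfolding quotE_def
proof (rule denotes_eq[OF denotes_sumE[OF denotes_powE[OF denotes_mE]]])
  fix acc k
  show "denotes (leE (Times (Plus (Var 9) (Num 1)) (powE e)) (Var 8)) (env(3 := acc, 9 := real k))
      (of_bool ((real k + 1) * real (n ^ w) \<le> real x))"
    using assms(1,3) by (intro denotes_intros denotes_powE e) auto
next
  have "(real k + 1) * real (n ^ w) \<le> real x \<longleftrightarrow> k < x div n ^ w" for k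
  proof -
    have "(real k + 1) * real (n ^ w) \<le> real x \<longleftrightarrow> real (Suc k * n ^ w) \<le> real x"
      by (simp add: algebra_simps)
    also have "\<dots> \<longleftrightarrow> Suc k \<le> x div n ^ w"
      unfolding of_nat_le_iff using n_pos by (subst less_eq_div_iff_mult_less_eq) auto
    finally show ?thesis by (simp add: Suc_le_eq)
  qed
  then have "(\<Sum>k<n ^ m. of_bool ((real k + 1) * real (n ^ w) \<le> real x)) =
      (\<Sum>k<n ^ m. of_bool (k < x div n ^ w) :: real)"
    by simp
  also have "\<dots> = real (card ({..<n ^ m} \<inter> {k. k < x div n ^ w}))"
    by (simp add: sum.If_cases of_bool_def)
  also have "{..<n ^ m} \<inter> {k. k < x div n ^ w} = {..<x div n ^ w}"
    using le_less_trans[OF div_le_dividend[of x "n ^ w"] assms(2)] by auto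
  finally show "(\<Sum>k<n ^ m. of_bool ((real k + 1) * real (n ^ w) \<le> real x)) = real (x div n ^ w)"
    by simp
qed (use M_ge in auto)

definition digit :: "nat \<Rightarrow> nat \<Rightarrow> nat" where
  "digit x v = x div n ^ v mod n"

text \<open>\<open>y mod n = y - n * (y div n)\<close>, applied to two successive quotients of
  \<open>x\<close>.\<close>

lemma denotes_digitE:
  assumes "env 8 = real x" "x < n ^ m" "env y = real v" "v < m" "y \<notin> {3, 9}"
  shows "denotes (digitE y) env (real (digit x v))"
  unfolding digitE_def
proof (rule denotes_eq)
  show "denotes (Minus (quotE (Var y)) (Times nE (quotE (Plus (Var y) (Num 1))))) env
      (real (x div n ^ v) - real n * real (x div n ^ (v + 1)))"
    using assms M_ge
    by (intro denotes_Minus denotes_Times denotes_nE denotes_quotE)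
      (auto intro: denotes_Var denotes_eq[OF denotes_Plus[OF denotes_Var[OF refl] denotes_Num]])
  have "real (x div n ^ v) = real (n * (x div n ^ v div n) + x div n ^ v mod n)"
    by simp
  then show "real (x div n ^ v) - real n * real (x div n ^ (v + 1)) = real (digit x v)"
    by (simp add: digit_def div_mult2_eq[symmetric] mult.commute del: mult_div_mod_eq)
qed

lemma digit_less: "digit x v < n"
  using n_pos by (simp add: digit_def)

lemma denotes_thresholdE:
  assumes "env 8 = real x" "x < n ^ m" "env y = real v" "v < m" "y \<notin> {3, 4, 9, 11, 12}"
  shows "denotes (thresholdE y) env (threshold d eps C V v (digit x v))"
  unfolding thresholdE_def
proof (rule denotes_letE)
  show "denotes (digitE y) env (real (digit x v))"
    using assms by (intro denotes_digitE) auto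
  let ?env = "env(11 := real (digit x v), 12 := 0)"
  have "denotes (Plus (distE y 11) (IfLe (Var 11) (Num 0) epsE (Num 0))) ?env
      (linf d (V v) (C (digit x v)) + (if real (digit x v) \<le> 0 then eps else 0))"
    using assms digit_less by (intro denotes_intros denotes_distE denotes_epsE) auto
  then show "denotes (Plus (distE y 11) (IfLe (Var 11) (Num 0) epsE (Num 0))) ?env
      (threshold d eps C V v (digit x v))"
    by (simp add: threshold_def)
qed

abbreviation profile :: "nat \<Rightarrow> nat \<Rightarrow> real" where
  "profile x v \<equiv> threshold d eps C V v (digit x v)"

abbreviation rank_in :: "nat \<Rightarrow> nat \<Rightarrow> nat \<Rightarrow> nat" where
  "rank_in x v \<equiv> rank_at n (\<lambda>i. linf d (V v) (C i)) (profile x v)"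

text \<open>Both cases of \<open>rank_at\<close> count the competitors closer than a pivot
  \<open>s\<close>: the target's bound for candidate 0, the candidate's own distance otherwise. One
  sum therefore serves both, and the tie term is added for competitors only.\<close>

lemma denotes_rankE:
  assumes "env 8 = real x" "x < n ^ m" "env y = real v" "v < m" "y \<notin> {3, 4, 5, 9, 11, 12}"
    "env z = real j" "j < n" "z \<notin> {3, 4, 5}"
  shows "denotes (rankE y z) env (real (rank_in x v j))"
proof -
  let ?D = "\<lambda>i. linf d (V v) (C i)"
  define s where "s = (if j = 0 then profile x v else ?D j)"
  have dist: "denotes (distE y z) env' (?D j)" if "env' y = real v" "env' z = real j" for env'
    using assms that by (intro denotes_distE) auto
  have thr: "denotes (thresholdE y) env' (profile x v)" if "env' 8 = real x" "env' y = real v" for env'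
    using assms that by (intro denotes_thresholdE) auto
  have s: "denotes (IfLe (Var z) (Num 0) (thresholdE y) (distE y z)) env' s"
    if "env' 8 = real x" "env' y = real v" "env' z = real j" for env'
    by (rule denotes_eq[OF denotes_IfLe[OF denotes_Var[of env' z, OF that(3)] denotes_Num thr[OF that(1,2)] dist[OF that(2,3)]]])
      (simp add: s_def)
  have "denotes (sumE 5 nE (IfLe (Num 1) (Var 5)
      (IfLe (IfLe (Var z) (Num 0) (thresholdE y) (distE y z)) (distE y 5) (Num 0) (Num 1)) (Num 0))) env
      (\<Sum>i<n. if 1 \<le> real i then (if s \<le> ?D i then 0 else 1) else 0)"
  proof (rule denotes_sumE[OF denotes_nE])
    fix acc i assume i: "i < n"
    let ?env = "env(3 := acc, 5 := real i)"
    have env: "?env 8 = real x" "?env y = real v" "?env z = real j" "?env 5 = real i"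
      using assms by auto
    have "denotes (distE y 5) ?env (?D i)"
      using assms i env by (intro denotes_distE) auto
    then show "denotes (IfLe (Num 1) (Var 5)
        (IfLe (IfLe (Var z) (Num 0) (thresholdE y) (distE y z)) (distE y 5) (Num 0) (Num 1)) (Num 0)) ?env
        (if 1 \<le> real i then (if s \<le> ?D i then 0 else 1) else 0)"
      by (intro denotes_IfLe denotes_Num denotes_Var s env)
  qed (use M_ge in auto)
  from denotes_Plus[OF denotes_Plus[OF denotes_Num this] denotes_IfLe[OF denotes_Num
      denotes_Var[of env z, OF assms(6)] denotes_leE[OF thr[OF assms(1,3)] dist[OF assms(3,6)]] denotes_Num], of 1 1 0]
  have *: "denotes (rankE y z) env
      (1 + (\<Sum>i<n. if 1 \<le> real i then (if s \<le> ?D i then 0 else 1) else 0)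
       + (if 1 \<le> real j then of_bool (profile x v \<le> ?D j) else 0))"
    unfolding rankE_def .
  have "(\<Sum>i<n. if 1 \<le> real i then (if s \<le> ?D i then 0 else 1) else 0)
      = (\<Sum>i<n. if 1 \<le> i \<and> ?D i < s then 1 else (0 :: real))"
    by (intro sum.cong) auto
  also have "\<dots> = real (card ({..<n} \<inter> {i. 1 \<le> i \<and> ?D i < s}))"
    by (simp add: sum.If_cases)
  also have "{..<n} \<inter> {i. 1 \<le> i \<and> ?D i < s} = {i. 1 \<le> i \<and> i < n \<and> ?D i < s}"
    by auto
  finally show ?thesis
    by (intro denotes_eq[OF *]) (auto simp: rank_at_def s_def)
qed

lemma denotes_scoreE:
  assumes "env 8 = real x" "x < n ^ m" "env z = real j" "j < n" "z \<notin> {3, 4, 5, 6}"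
  shows "denotes (scoreE z) env (\<Sum>v<m. f (rank_in x v j))"
  unfolding scoreE_def
proof (rule denotes_sumE[OF denotes_mE])
  fix acc v assume "v < m"
  then have "denotes (rankE 6 z) (env(3 := acc, 6 := real v)) (real (rank_in x v j))"
    using assms by (intro denotes_rankE) auto
  then show "denotes (fE (rankE 6 z)) (env(3 := acc, 6 := real v)) (f (rank_in x v j))"
    using assms(4) by (intro denotes_fE rank_at_ge_1 rank_at_le)
qed (use M_ge in auto)

lemma denotes_winsE:
  assumes "env 8 = real x" "x < n ^ m"
  shows "denotes winsE env (of_bool (wins_at n m d f C V (profile x)))"
proof -
  have *: "denotes winsE env (of_bool (\<forall>j<n. (\<Sum>v<m. f (rank_in x v j)) \<le> (\<Sum>v<m. f (rank_in x v 0))))"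
    unfolding winsE_def using assms M_ge n_pos
    by (intro denotes_letE[OF denotes_Num] denotes_prodE_of_bool denotes_nE denotes_leE denotes_scoreE) auto
  have "(\<forall>j<n. (\<Sum>v<m. f (rank_in x v j)) \<le> (\<Sum>v<m. f (rank_in x v 0))) \<longleftrightarrow>
      wins_at n m d f C V (profile x)"
    unfolding wins_at_def
  proof (intro iffI allI impI)
    fix j assume "\<forall>j. 1 \<le> j \<and> j < n \<longrightarrow> (\<Sum>v<m. f (rank_in x v j)) \<le> (\<Sum>v<m. f (rank_in x v 0))" "j < n"
    then show "(\<Sum>v<m. f (rank_in x v j)) \<le> (\<Sum>v<m. f (rank_in x v 0))"
      by (cases "j = 0") auto
  qed auto
  with * show ?thesis by simp
qed

lemma denotes_boxesE:
  assumes "env 8 = real x" "x < n ^ m"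
  shows "denotes boxesE env (of_bool (boxes_meet m d eps C V (profile x)))"
  unfolding boxesE_def boxes_meet_def
proof (rule denotes_prodE_of_bool[OF denotes_dE _ _ denotes_prodE_of_bool[OF denotes_mE]])
  fix acc acc' k u assume k: "k < d" and u: "u < m"
  let ?env = "env(3 := acc, 15 := real k, 3 := acc', 6 := real u)"
  have c: "denotes (candE (Num 0) (Var 15)) ?env (C 0 k)"
    using k n_pos by (intro denotes_candE denotes_Var denotes_eq[OF denotes_Num]) auto
  have v: "denotes (voterE (Var 6) (Var 15)) ?env (V u k)"
    using k u by (intro denotes_voterE denotes_Var) auto
  have t: "denotes (thresholdE 6) ?env (profile x u)"
    using assms u by (intro denotes_thresholdE) auto
  have "denotes (prodE 14 mE (leE (Minus (voterE (Var 6) (Var 15)) (thresholdE 6))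
      (Plus (voterE (Var 14) (Var 15)) (thresholdE 14)))) ?env
      (of_bool (\<forall>w<m. V u k - profile x u \<le> V w k + profile x w))"
  proof (rule denotes_prodE_of_bool[OF denotes_mE])
    fix acc'' w assume w: "w < m"
    let ?env' = "?env(3 := acc'', 14 := real w)"
    show "denotes (leE (Minus (voterE (Var 6) (Var 15)) (thresholdE 6))
        (Plus (voterE (Var 14) (Var 15)) (thresholdE 14))) ?env'
        (of_bool (V u k - profile x u \<le> V w k + profile x w))"
      using assms k u w
      by (intro denotes_leE denotes_Minus denotes_Plus denotes_voterE denotes_thresholdE denotes_Var) auto
  qed (use M_ge in auto)
  from denotes_Times[OF denotes_Times[OF
      denotes_leE[OF denotes_Minus[OF c denotes_epsE] denotes_Plus[OF v t]]
      denotes_leE[OF denotes_Minus[OF v t] denotes_Plus[OF c denotes_epsE]]] this]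
  show "denotes (Times
     (Times (leE (Minus (candE (Num 0) (Var 15)) epsE) (Plus (voterE (Var 6) (Var 15)) (thresholdE 6)))
            (leE (Minus (voterE (Var 6) (Var 15)) (thresholdE 6)) (Plus (candE (Num 0) (Var 15)) epsE)))
     (prodE 14 mE (leE (Minus (voterE (Var 6) (Var 15)) (thresholdE 6))
                       (Plus (voterE (Var 14) (Var 15)) (thresholdE 14))))) ?env
      (of_bool ((C 0 k - eps \<le> V u k + profile x u \<and> V u k - profile x u \<le> C 0 k + eps) \<and>
       (\<forall>w<m. V u k - profile x u \<le> V w k + profile x w)))"
    by (simp only: of_bool_conj)
qed (use M_ge in auto)

lemma denotes_controlE:
  assumes "valid_instance n m d eps f C V"
  shows "denotes controlE env (of_bool (constructive_control n m d eps f C V))"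
proof -
  let ?Q = "\<lambda>x. boxes_meet m d eps C V (profile x) \<and> wins_at n m d f C V (profile x)"
  have *: "denotes controlE env (of_bool ((1 :: real) \<le> (\<Sum>x<n ^ m.
      of_bool (boxes_meet m d eps C V (profile x)) * of_bool (wins_at n m d f C V (profile x)))))"
    unfolding controlE_def using M_ge
    by (intro denotes_leE denotes_Num denotes_sumE denotes_powE denotes_mE denotes_Times
        denotes_boxesE denotes_winsE) auto
  have "(\<Sum>x<n ^ m. of_bool (boxes_meet m d eps C V (profile x)) * of_bool (wins_at n m d f C V (profile x)))
      = (\<Sum>x<n ^ m. if ?Q x then 1 else (0 :: real))"
    by (intro sum.cong) auto
  also have "\<dots> = real (card ({..<n ^ m} \<inter> {x. ?Q x}))"
    by (simp add: sum.If_cases)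
  finally have "1 \<le> (\<Sum>x<n ^ m. of_bool (boxes_meet m d eps C V (profile x)) *
      of_bool (wins_at n m d f C V (profile x)) :: real) \<longleftrightarrow> 1 \<le> card ({..<n ^ m} \<inter> {x. ?Q x})"
    by simp
  also have "\<dots> \<longleftrightarrow> (\<exists>x<n ^ m. ?Q x)"
    by (auto simp: Suc_le_eq card_gt_0_iff)
  also have "\<dots> \<longleftrightarrow> constructive_control n m d eps f C V"
    unfolding constructive_control_iff_profile[OF assms]
  proof
    assume "\<exists>x<n ^ m. ?Q x"
    then obtain x where "?Q x" by blast
    then show "\<exists>b. (\<forall>v<m. b v < n) \<and> boxes_meet m d eps C V (\<lambda>v. threshold d eps C V v (b v)) \<and>
         wins_at n m d f C V (\<lambda>v. threshold d eps C V v (b v))"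
      using digit_less by (intro exI[of _ "digit x"]) simp
  next
    assume "\<exists>b. (\<forall>v<m. b v < n) \<and> boxes_meet m d eps C V (\<lambda>v. threshold d eps C V v (b v)) \<and>
         wins_at n m d f C V (\<lambda>v. threshold d eps C V v (b v))"
    then obtain b where b: "\<forall>v<m. b v < n" "boxes_meet m d eps C V (\<lambda>v. threshold d eps C V v (b v))"
         "wins_at n m d f C V (\<lambda>v. threshold d eps C V v (b v))" by blast
    from digits_surjective[OF b(1)] obtain x where x: "x < n ^ m" "\<And>v. v < m \<Longrightarrow> digit x v = b v"
      by (auto simp: digit_def)
    \<comment> \<open>\<open>b\<close> and the digits of \<open>x\<close> agree on all
      \<open>v < m\<close>, the only voters that the two predicates inspect.\<close>
    have "?Q x" using b(2,3) x(2) by (simp add: boxes_meet_def wins_at_def)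
    with x(1) show "\<exists>x<n ^ m. ?Q x" by blast
  qed
  finally show ?thesis using * by simp
qed

end

section \<open>The input encoding\<close>

lemma length_concat_rows: "length (concat (map (\<lambda>i. map (g i) [0..<d]) [0..<n])) = n * d"
  by (induction n) auto

lemma nth_concat_rows:
  assumes "i < n" "k < d"
  shows "concat (map (\<lambda>i. map (g i) [0..<d]) [0..<n]) ! (i * d + k) = g i k"
  using assms
proof (induction n)
  case (Suc n)
  show ?case
  proof (cases "i = n")
    case True
    then show ?thesis using Suc.prems by (simp add: nth_append length_concat_rows)
  next
    case False
    with Suc.prems have "i < n" by simp
    then have "(i + 1) * d \<le> n * d" by (intro mult_le_mono) auto
    then have "i * d + k < n * d" using Suc.prems by simp
    then show ?thesis using Suc \<open>i < n\<close> by (simp add: nth_append length_concat_rows)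
  qed
qed simp

lemma length_encode: "length (encode n m d eps f C V) = 4 + n + (n + m) * d"
  by (simp add: encode_def length_concat_rows algebra_simps)

lemma election_input_encode:
  assumes "1 \<le> n" "1 \<le> d" "n \<le> M" "m \<le> M" "d \<le> M" "n ^ m \<le> M" "1 \<le> M"
  shows "election_input n m d eps f C V (snd (init_state (encode n m d eps f C V))) M"
proof -
  define xs where "xs = encode n m d eps f C V"
  define inp where "inp = snd (init_state xs)"
  have len: "length xs = 4 + n + (n + m) * d" by (simp add: xs_def length_encode)
  have inp: "inp i = xs ! i" if "i < length xs" for i
    using that by (simp add: inp_def init_state_def)
  have f: "inp (3 + t) = f t" if "1 \<le> t" "t \<le> n" for t
  proof -
    have t: "t - 1 < n" using that by simp
    have "inp (3 + t) = xs ! (4 + (t - 1))" using inp[of "3 + t"] that by (simp add: len)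
    also have "\<dots> = map f [1..<n + 1] ! (t - 1)"
      using t by (simp add: xs_def encode_def nth_append del: upt_Suc)
    also have "\<dots> = f t" using t that by (simp del: upt_Suc)
    finally show ?thesis .
  qed
  have row: "i * d + k < n' * d" if "i < n'" "k < d" for i k n'
  proof -
    have "(i + 1) * d \<le> n' * d" using that by (intro mult_le_mono) auto
    with that show ?thesis by simp
  qed
  have C: "inp (4 + n + (i * d + k)) = C i k" if "i < n" "k < d" for i k
  proof -
    have "inp (4 + n + (i * d + k)) = xs ! (4 + n + (i * d + k))"
      using row[OF that] by (intro inp) (simp add: len algebra_simps)
    also have "\<dots> = C i k"
      using row[OF that] nth_concat_rows[OF that, of C]
      by (simp add: xs_def encode_def nth_append length_concat_rows del: upt_Suc)
    finally show ?thesis .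
  qed
  have V: "inp (4 + n + (n * d + (v * d + k))) = V v k" if "v < m" "k < d" for v k
  proof -
    have "inp (4 + n + (n * d + (v * d + k))) = xs ! (4 + n + (n * d + (v * d + k)))"
      using row[OF that] by (intro inp) (simp add: len algebra_simps)
    also have "\<dots> = V v k"
      using nth_concat_rows[OF that, of V]
      by (simp add: xs_def encode_def nth_append length_concat_rows del: upt_Suc)
    finally show ?thesis .
  qed
  have "inp 0 = real n" "inp 1 = real m" "inp 2 = real d" "inp 3 = eps"
    by (simp_all add: inp len) (simp_all add: xs_def encode_def numeral_eq_Suc)
  then show ?thesis
    unfolding xs_def[symmetric] inp_def[symmetric] using assms f C V by unfold_locales
qed

section \<open>Assembling the program and counting its steps\<close>

theorem theorem11:
  shows "\<exists>P :: prog. \<forall>m :: nat. \<exists>c k :: nat.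
           \<forall>n d eps f C V. valid_instance n m d eps f C V \<longrightarrow>
             decides_within P (encode n m d eps f C V)
               (c * (length (encode n m d eps f C V) + 1) ^ k)
               (constructive_control n m d eps f C V)"
proof -
  define code where "code = relocate ;; compile controlE 16 ;; (\<lambda>_. [Add 0 16 2])"
  obtain c k where ck: "\<And>M. cost M controlE \<le> c * (M + 1) ^ k"
    using cost_polynomial by blast
  \<comment> \<open>\<open>c * 2 ^ k\<close> comes from \<open>M + 1 \<le> 2 * M\<close> in the cost
    bound, and 51 pays for the relocation and the final move. The code does not mention
    \<open>m\<close>, which enters only the exponent.\<close>
  have "decides_within (code 0) (encode n m d eps f C V)
      ((c * 2 ^ k + 51) * (length (encode n m d eps f C V) + 1) ^ ((m + 1) * k + 1))
      (constructive_control n m d eps f C V)"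
    if valid: "valid_instance n m d eps f C V" for n m d eps f C V
  proof -
    define L where "L = length (encode n m d eps f C V)"
    define inp where "inp = snd (init_state (encode n m d eps f C V))"
    define A where "A = 1024 * (n + (n + m) * d)"
    \<comment> \<open>One bound for all loops: \<open>n\<close>, \<open>m\<close>, \<open>d\<close>
      are at most \<open>L + 1\<close>, and \<open>n ^ m\<close> is at most
      \<open>(L + 1) ^ m\<close>.\<close>
    define M where "M = (L + 1) ^ (m + 1)"
    have nd: "1 \<le> n" "1 \<le> d" using valid by (auto simp: valid_instance_def)
    have L: "L = 4 + n + (n + m) * d" by (simp add: L_def length_encode)
    have M1: "L + 1 \<le> M" unfolding M_def using self_le_power[of "L + 1" "m + 1"] by simp
    \<comment> \<open>Naming the product leaves linear facts only; \<open>n + m \<le> q\<close> uses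
      \<open>d \<ge> 1\<close>, and \<open>d \<le> q\<close> uses \<open>n \<ge> 1\<close>.\<close>
    define q where "q = (n + m) * d"
    have q: "n + m \<le> q" "d \<le> q" "L = 4 + n + q" using nd by (simp_all add: q_def L)
    then have le: "n \<le> M" "m \<le> M" "d \<le> M" "1 \<le> M" using M1 by simp_all
    have "n ^ m \<le> (L + 1) ^ m" using L by (intro power_mono) auto
    also have "\<dots> \<le> M" unfolding M_def by (intro power_increasing) auto
    finally have "n ^ m \<le> M" .
    with le nd interpret election_input n m d eps f C V inp M
      unfolding inp_def by (intro election_input_encode)
    have "inp i = 0" if "L \<le> i" for i using that by (simp add: inp_def init_state_def L_def)
    from relocate_correct[OF nd L inp_n inp_m inp_d this A_def]
    obtain R where R: "exec relocate inp (50 * (L + 1)) R" "machine_inv A inp R" by blast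
    have den: "denotes controlE R (of_bool (constructive_control n m d eps f C V))"
      by (rule denotes_controlE[OF valid])
    have "A = 1024 * (n + q)" by (simp add: A_def q_def)
    moreover have "2 \<le> n + q" using nd(1) q(1) by linarith
    ultimately have "2048 \<le> A" by simp
    then have "16 + width controlE \<le> A" using controlE_width by simp
    then have "computes (compile controlE 16) (cost M controlE) R 16 (width controlE)
        (eval inp controlE R)"
      using den by (intro compile_correct[OF _ controlE_wf R(2)]) (auto simp: denotes_def)
    then obtain R1 where R1: "exec (compile controlE 16) R (cost M controlE) R1"
        "R1 16 = of_bool (constructive_control n m d eps f C V)" "R1 2 = R 2"
      using den by (auto simp: computes_def denotes_def)
    have "exec (\<lambda>_. [Add 0 16 2]) R1 1 (R1(0 := R1 16))"
      using R(2) R1(3) by (intro exec_mono[OF exec_effects]) (auto simp: machine_inv_def)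
    from exec_seq[OF exec_seq[OF R(1) R1(1)] this]
    have "exec code inp (50 * (L + 1) + cost M controlE + 1) (R1(0 := R1 16))"
      unfolding code_def .
    moreover have "code_at (code 0) 0 (code 0)" by (simp add: code_at_def)
    ultimately obtain t where t: "t \<le> 50 * (L + 1) + cost M controlE + 1"
        "run (code 0) t (0, inp) = (length (code 0), R1(0 := R1 16))"
      unfolding exec_def by (metis add_0)
    have "init_state (encode n m d eps f C V) = (0, inp)"
      by (simp add: inp_def init_state_def)
    moreover have "t \<le> (c * 2 ^ k + 51) * (L + 1) ^ ((m + 1) * k + 1)"
    proof -
      have "(M + 1) ^ k \<le> (2 * M) ^ k" using le(4) by (intro power_mono) auto
      then have "cost M controlE \<le> c * (2 * M) ^ k"
        by (intro order_trans[OF ck[of M]] mult_le_mono2)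
      also have "\<dots> = c * 2 ^ k * (L + 1) ^ ((m + 1) * k)"
        by (simp only: M_def power_mult_distrib power_mult mult.assoc)
      also have "\<dots> \<le> c * 2 ^ k * (L + 1) ^ ((m + 1) * k + 1)"
        by (intro mult_le_mono le_refl power_increasing) auto
      finally have 1: "cost M controlE \<le> c * 2 ^ k * (L + 1) ^ ((m + 1) * k + 1)" .
      have "(L + 1) ^ 1 \<le> (L + 1) ^ ((m + 1) * k + 1)" by (intro power_increasing) auto
      then have "50 * (L + 1) + 1 \<le> 51 * (L + 1) ^ ((m + 1) * k + 1)" by simp
      with 1 t(1) show ?thesis unfolding add_mult_distrib by linarith
    qed
    ultimately show ?thesis
      unfolding decides_within_def L_def using t(2) R1(2)
      by (intro exI[of _ t]) (simp add: halted_def)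
  qed
  then show ?thesis by blast
qed

end
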